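(* Let $A=A_1\oplus A_2$, where for $i=1,2$ the operator $A_i=(A^i_{kl})_{1\le k,l\le n}$ in $M_n(L^\infty(\mu))$ is upper triangular ($A^i_{kl}=0$ for $k>l$), such that (1) $A^i_{kk}=A^i_{ll}$ for $i=1,2$ and $k,l=1,\dots,n$; (2) the support of $A^i_{k,k+1}$ is $\Lambda$ for $i=1,2$ and $k=1,\dots,n-1$. If the $K_0$ group of the relative commutant $\{A\}'\cap M_{2n}(L^\infty(\mu))$ is of the form $$K_0(\{A\}'\cap M_{2n}(L^\infty(\mu)))\cong\{\phi:\Lambda\to\mathbb Z\mid\phi\text{ is bounded Borel}\},$$ then $A_1$ and $A_2$ are similar to each other in $M_n(L^\infty(\mu))$.
   Context: $\mu$ is (the completion of) a finite positive regular Borel measure supported on a compact subset $\Lambda$ of $\mathbb C$. Elements of $L^\infty(\mu)$ are regarded as multiplication operators on $L^2(\mu)$, and $M_n(L^\infty(\mu))$ acts on $(L^2(\mu))^{(n)}$. The relative commutant is $\{A\}'\cap M_{2n}(L^\infty(\mu))=\{B\in M_{2n}(L^\infty(\mu)):AB=BA\}$, a unital Banach algebra, and $K_0$ is its $K_0$-group in the sense of $K$-theory for Banach algebras. "The support of $f$ is $\Lambda$" means $f(\lambda)\ne0$ for $\mu$-almost every $\lambda\in\Lambda$. Borel functions are treated as representatives of classes modulo $\mu$-almost everywhere equality, with pointwise addition. $A_1$ and $A_2$ are similar in $M_n(L^\infty(\mu))$ if $XA_1X^{-1}=A_2$ for some invertible $X\in M_n(L^\infty(\mu))$.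
   Formalization: The isomorphism of K_0 with the bounded Borel functions is also assumed to respect restriction to Borel subsets of Λ (θ[χ_σ e] = χ_σ θ[e]); for a bare group isomorphism the claim fails, e.g. Lebesgue measure on [0,1], n=1, A_1=0, A_2=1. *)

theory Defs
  imports "HOL-Analysis.Analysis" "HOL-Algebra.QuotRing"
begin

section \<open>The algebra of essentially bounded functions\<close>

definition ess_bounded_ring :: "'x measure \<Rightarrow> ('x \<Rightarrow> complex) ring" where
  "ess_bounded_ring M =
    \<lparr>carrier = {f \<in> borel_measurable M. \<exists>c. AE x in M. norm (f x) \<le> c},
     mult = (\<lambda>f g x. f x * g x), one = (\<lambda>_. 1),
     zero = (\<lambda>_. 0), add = (\<lambda>f g x. f x + g x)\<rparr>"

definition null_functions :: "'x measure \<Rightarrow> ('x \<Rightarrow> complex) set" where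
  "null_functions M = {f \<in> borel_measurable M. AE x in M. f x = 0}"

definition Linf :: "'x measure \<Rightarrow> ('x \<Rightarrow> complex) set ring" where
  "Linf M = ess_bounded_ring M Quot null_functions M"

definition Linf_class :: "'x measure \<Rightarrow> ('x \<Rightarrow> complex) \<Rightarrow> ('x \<Rightarrow> complex) set" where
  "Linf_class M f = null_functions M +>\<^bsub>ess_bounded_ring M\<^esub> f"

text \<open>All representatives of a class agree almost everywhere, so it does not matter that all of
  them are quantified over.\<close>

definition full_support :: "'x measure \<Rightarrow> 'x set \<Rightarrow> ('x \<Rightarrow> complex) set \<Rightarrow> bool" where
  "full_support M \<Lambda> a \<longleftrightarrow> (\<forall>f\<in>a. AE x in M. x \<in> \<Lambda> \<longrightarrow> f x \<noteq> 0)"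


section \<open>Matrices over a ring\<close>

text \<open>Rows and columns are numbered from 0. An $m \times p$ matrix is a function of two indices
  that vanishes outside $\{0,\dots,m-1\} \times \{0,\dots,p-1\}$, so that equality of matrices is
  equality of functions. The first argument of \<open>mat_mult\<close> after the ring is the inner dimension.\<close>

definition mats :: "('a, 'c) ring_scheme \<Rightarrow> nat \<Rightarrow> nat \<Rightarrow> (nat \<Rightarrow> nat \<Rightarrow> 'a) set" where
  "mats R m p = {x. (\<forall>i<m. \<forall>j<p. x i j \<in> carrier R) \<and>
                    (\<forall>i j. \<not> (i < m \<and> j < p) \<longrightarrow> x i j = \<zero>\<^bsub>R\<^esub>)}"

definition mat_mult ::
  "('a, 'c) ring_scheme \<Rightarrow> nat \<Rightarrow> (nat \<Rightarrow> nat \<Rightarrow> 'a) \<Rightarrow> (nat \<Rightarrow> nat \<Rightarrow> 'a) \<Rightarrow> nat \<Rightarrow> nat \<Rightarrow> 'a" where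
  "mat_mult R k x y = (\<lambda>i j. \<Oplus>\<^bsub>R\<^esub>l\<in>{..<k}. x i l \<otimes>\<^bsub>R\<^esub> y l j)"

definition scalar_mat :: "('a, 'c) ring_scheme \<Rightarrow> nat \<Rightarrow> 'a \<Rightarrow> nat \<Rightarrow> nat \<Rightarrow> 'a" where
  "scalar_mat R n a = (\<lambda>i j. if i = j \<and> i < n then a else \<zero>\<^bsub>R\<^esub>)"

definition mat_ring :: "('a, 'c) ring_scheme \<Rightarrow> nat \<Rightarrow> (nat \<Rightarrow> nat \<Rightarrow> 'a) ring" where
  "mat_ring R n =
    \<lparr>carrier = mats R n n, mult = mat_mult R n, one = scalar_mat R n \<one>\<^bsub>R\<^esub>,
     zero = (\<lambda>_ _. \<zero>\<^bsub>R\<^esub>), add = (\<lambda>x y i j. x i j \<oplus>\<^bsub>R\<^esub> y i j)\<rparr>"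

text \<open>The direct sum $x \oplus y$ of square matrices, where $x$ has size $m$.\<close>

definition mat_dsum ::
  "('a, 'c) ring_scheme \<Rightarrow> nat \<Rightarrow> (nat \<Rightarrow> nat \<Rightarrow> 'a) \<Rightarrow> (nat \<Rightarrow> nat \<Rightarrow> 'a) \<Rightarrow> nat \<Rightarrow> nat \<Rightarrow> 'a" where
  "mat_dsum R m x y = (\<lambda>i j. if i < m \<and> j < m then x i j
                         else if m \<le> i \<and> m \<le> j then y (i - m) (j - m) else \<zero>\<^bsub>R\<^esub>)"

definition commutant :: "('a, 'c) ring_scheme \<Rightarrow> 'a \<Rightarrow> ('a, 'c) ring_scheme" where
  "commutant R a = R\<lparr>carrier := {b \<in> carrier R. a \<otimes>\<^bsub>R\<^esub> b = b \<otimes>\<^bsub>R\<^esub> a}\<rparr>"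

definition similar_in :: "('a, 'c) ring_scheme \<Rightarrow> 'a \<Rightarrow> 'a \<Rightarrow> bool" where
  "similar_in R a b \<longleftrightarrow> (\<exists>x\<in>Units R. x \<otimes>\<^bsub>R\<^esub> a \<otimes>\<^bsub>R\<^esub> inv\<^bsub>R\<^esub> x = b)"


section \<open>The $K_0$-group of a unital ring\<close>

text \<open>The $K_0$-group of a unital Banach algebra is the Grothendieck group of the monoid of
  algebraic equivalence classes of idempotent matrices; the norm plays no role. An idempotent in
  $\bigcup_m M_m(R)$ is a pair of its size and the matrix, and $e \sim f$ means that $e = xy$ and
  $f = yx$ for rectangular matrices $x$, $y$ over $R$. In particular an idempotent is identified
  with its extensions by zero.\<close>

definition idempotents :: "('a, 'c) ring_scheme \<Rightarrow> (nat \<times> (nat \<Rightarrow> nat \<Rightarrow> 'a)) set" where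
  "idempotents R = {(m, e). e \<in> mats R m m \<and> mat_mult R m e e = e}"

definition alg_equiv ::
  "('a, 'c) ring_scheme \<Rightarrow> ((nat \<times> (nat \<Rightarrow> nat \<Rightarrow> 'a)) \<times> (nat \<times> (nat \<Rightarrow> nat \<Rightarrow> 'a))) set" where
  "alg_equiv R = {((m, e), (p, f)). (m, e) \<in> idempotents R \<and> (p, f) \<in> idempotents R \<and>
     (\<exists>x\<in>mats R m p. \<exists>y\<in>mats R p m. mat_mult R p x y = e \<and> mat_mult R m y x = f)}"

definition V_monoid :: "('a, 'c) ring_scheme \<Rightarrow> (nat \<times> (nat \<Rightarrow> nat \<Rightarrow> 'a)) set monoid" where
  "V_monoid R =
    \<lparr>carrier = idempotents R // alg_equiv R,
     mult = (\<lambda>X Y. \<Union>(m, e)\<in>X. \<Union>(p, f)\<in>Y. alg_equiv R `` {(m + p, mat_dsum R m e f)}),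
     one = alg_equiv R `` {(0, \<lambda>_ _. \<zero>\<^bsub>R\<^esub>)}\<rparr>"

text \<open>The Grothendieck group of a commutative monoid, with $(a, b)$ representing the formal
  difference of $a$ and $b$. The group operation is written multiplicatively.\<close>

definition grothendieck_rel :: "('a, 'c) monoid_scheme \<Rightarrow> (('a \<times> 'a) \<times> ('a \<times> 'a)) set" where
  "grothendieck_rel G = {((a, b), (c, d)). a \<in> carrier G \<and> b \<in> carrier G \<and> c \<in> carrier G \<and>
     d \<in> carrier G \<and> (\<exists>k\<in>carrier G. a \<otimes>\<^bsub>G\<^esub> d \<otimes>\<^bsub>G\<^esub> k = c \<otimes>\<^bsub>G\<^esub> b \<otimes>\<^bsub>G\<^esub> k)}"

definition grothendieck_group :: "('a, 'c) monoid_scheme \<Rightarrow> ('a \<times> 'a) set monoid" where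
  "grothendieck_group G =
    \<lparr>carrier = (carrier G \<times> carrier G) // grothendieck_rel G,
     mult = (\<lambda>X Y. \<Union>(a, b)\<in>X. \<Union>(c, d)\<in>Y.
               grothendieck_rel G `` {(a \<otimes>\<^bsub>G\<^esub> c, b \<otimes>\<^bsub>G\<^esub> d)}),
     one = grothendieck_rel G `` {(\<one>\<^bsub>G\<^esub>, \<one>\<^bsub>G\<^esub>)}\<rparr>"

definition K0 ::
  "('a, 'c) ring_scheme \<Rightarrow>
     ((nat \<times> (nat \<Rightarrow> nat \<Rightarrow> 'a)) set \<times> (nat \<times> (nat \<Rightarrow> nat \<Rightarrow> 'a)) set) set monoid" where
  "K0 R = grothendieck_group (V_monoid R)"

definition K0_class ::
  "('a, 'c) ring_scheme \<Rightarrow> nat \<Rightarrow> (nat \<Rightarrow> nat \<Rightarrow> 'a) \<Rightarrow>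
     ((nat \<times> (nat \<Rightarrow> nat \<Rightarrow> 'a)) set \<times> (nat \<times> (nat \<Rightarrow> nat \<Rightarrow> 'a)) set) set" where
  "K0_class R m e =
     grothendieck_rel (V_monoid R) `` {(alg_equiv R `` {(m, e)}, \<one>\<^bsub>V_monoid R\<^esub>)}"


section \<open>Bounded Borel functions with integer values\<close>

definition bounded_borel_int_fun :: "complex set \<Rightarrow> (complex \<Rightarrow> int) monoid" where
  "bounded_borel_int_fun \<Lambda> =
    \<lparr>carrier = {\<phi> \<in> \<Lambda> \<rightarrow>\<^sub>E UNIV. \<phi> \<in> restrict_space borel \<Lambda> \<rightarrow>\<^sub>M count_space UNIV \<and>
                                  (\<exists>c. \<forall>x\<in>\<Lambda>. \<bar>\<phi> x\<bar> \<le> c)},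
     mult = (\<lambda>\<phi> \<psi>. \<lambda>x\<in>\<Lambda>. \<phi> x + \<psi> x), one = (\<lambda>x\<in>\<Lambda>. 0)\<rparr>"

definition bounded_borel_int :: "complex measure \<Rightarrow> complex set \<Rightarrow> (complex \<Rightarrow> int) set monoid" where
  "bounded_borel_int M \<Lambda> = bounded_borel_int_fun \<Lambda> Mod
     {\<phi> \<in> carrier (bounded_borel_int_fun \<Lambda>). AE x in M. x \<in> \<Lambda> \<longrightarrow> \<phi> x = 0}"


section \<open>Isomorphisms over the base\<close>

text \<open>A Borel set \<open>\<sigma> \<subseteq> \<Lambda>\<close> gives the central projection \<open>\<chi>\<^sub>\<sigma> I\<close> of $M_N(L^\infty)$. It lies
  in every relative commutant and cuts an idempotent matrix $e$ over it down to \<open>\<chi>\<^sub>\<sigma> e\<close>.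
  On functions the corresponding operation is multiplication by \<open>\<chi>\<^sub>\<sigma>\<close>. A group isomorphism
  between the $K_0$-group and the functions is required to intertwine the two, i.e.
  \<open>\<theta> [\<chi>\<^sub>\<sigma> e] = \<chi>\<^sub>\<sigma> \<theta> [e]\<close>: it is an isomorphism of modules over the ring of bounded Borel
  functions from \<open>\<Lambda>\<close> to the integers. An isomorphism of bare groups says very little here: for
  Lebesgue measure on \<open>\<Lambda> = [0,1]\<close>, a null-set preserving Borel isomorphism of \<open>\<Lambda>\<close> with two disjoint copies of itself
  identifies the function group with its own square, which is the $K_0$-group for $A_1 = 0$,
  $A_2 = 1$, $n = 1$.\<close>

definition cut_down ::
  "complex measure \<Rightarrow> nat \<Rightarrow> complex set \<Rightarrow>
     (nat \<Rightarrow> nat \<Rightarrow> nat \<Rightarrow> nat \<Rightarrow> (complex \<Rightarrow> complex) set) \<Rightarrow>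
     (nat \<Rightarrow> nat \<Rightarrow> nat \<Rightarrow> nat \<Rightarrow> (complex \<Rightarrow> complex) set)" where
  "cut_down M N \<sigma> e =
     (\<lambda>i j. scalar_mat (Linf M) N (Linf_class M (indicator \<sigma>)) \<otimes>\<^bsub>mat_ring (Linf M) N\<^esub> e i j)"

definition K0_iso_bounded_borel_int ::
  "complex measure \<Rightarrow> complex set \<Rightarrow> nat \<Rightarrow> (nat \<Rightarrow> nat \<Rightarrow> (complex \<Rightarrow> complex) set) \<Rightarrow> bool" where
  "K0_iso_bounded_borel_int M \<Lambda> N A \<longleftrightarrow>
     (let C = commutant (mat_ring (Linf M) N) A in
       \<exists>\<theta> \<in> iso (K0 C) (bounded_borel_int M \<Lambda>).
         \<forall>\<sigma> \<in> sets borel. \<sigma> \<subseteq> \<Lambda> \<longrightarrow>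
           (\<forall>(m, e) \<in> idempotents C. \<forall>\<phi> \<in> \<theta> (K0_class C m e).
              (\<lambda>x\<in>\<Lambda>. indicator \<sigma> x * \<phi> x) \<in> \<theta> (K0_class C m (cut_down M N \<sigma> e))))"

end

theory Submission
  imports Defs "HOL-Algebra.Subrings"
begin

text \<open>Write $V_i$ for $L^\infty(\mu)^n$ with $A_i$ acting on it, so that the relative commutant
  $C$ of $A_1 \oplus A_2$ is the endomorphism ring of $V_1 \oplus V_2$, and let $E_1, E_2 \in C$ be
  the two projections.

  The matrix trace gives a homomorphism from $K_0(C)$ to $L^\infty(\mu)$. Both $\chi_\sigma E_1$ and
  $\chi_\sigma E_2$ have trace $n \chi_\sigma$. If $[E_1]$ and $[E_2]$ correspond to functions that
  take distinct values $a$ and $b$ on $\sigma$, then $b [\chi_\sigma E_1] = a [\chi_\sigma E_2]$, and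
  comparing traces shows that $\sigma$ is null. Hence $[E_1] = [E_2]$ in $K_0(C)$.

  All homomorphisms between the $V_i$ are upper triangular. So modulo the ideal $J_k$ of the $k$-th
  diagonal entries of homomorphisms $V_1 \to V_2$, the $k$-th diagonal entry of the corner
  $V_1 \to V_1$ is a multiplicative function of the element of $C$. It factors through $K_0$ and
  takes the values $1$ at $E_1$ and $0$ at $E_2$, so $1 \in J_k$: there is an intertwiner $u_k$ with
  $k$-th diagonal entry $1$. The superdiagonal entries force the diagonals of all intertwiners to be
  proportional, which gives $(u_0)_{kk} (u_k)_{00} = 1$. Thus $u_0$ is triangular with invertible
  diagonal entries, and it implements the similarity.\<close>

section \<open>Matrices over a ring\<close>

text \<open>\<open>K0\<close> of the commutant is never computed; an equality in it is only tested
  by homomorphisms out of it. \<open>K0_trace\<close> supplies these: an additive map t to an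
  abelian group with t (x y) = t (y x) extends to \<open>K0\<close>. It is used twice, with the
  matrix trace and with one diagonal entry modulo an ideal. The latter is a trace because it is
  multiplicative into a commutative quotient: the only cross term in the k-th diagonal entry of a
  product passes through the corner V_1 -> V_2, whose k-th diagonal entries form the ideal.
  Compatibility of the isomorphism with cut-downs is what identifies the images of the projections
  cut down to a set on which the representing functions are constant. Distinct integer values are
  then excluded because the additive group of L-infinity has no torsion. No relation between the
  diagonals of A_1 and A_2 is assumed. Where they differ, every intertwiner vanishes, because
  L-infinity is reduced. This gives triangularity of intertwiners before the diagonals are known to
  agree.\<close>

lemma (in abelian_monoid) finsum_swap:
  assumes "finite A" "finite B" "\<And>i j. i \<in> A \<Longrightarrow> j \<in> B \<Longrightarrow> f i j \<in> carrier G"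
  shows "(\<Oplus>i\<in>A. \<Oplus>j\<in>B. f i j) = (\<Oplus>j\<in>B. \<Oplus>i\<in>A. f i j)"
  using assms(1,3)
proof (induction A rule: finite_induct)
  case empty
  then show ?case by simp
next
  case (insert a A)
  have "(\<Oplus>i\<in>insert a A. \<Oplus>j\<in>B. f i j) = (\<Oplus>j\<in>B. f a j) \<oplus> (\<Oplus>i\<in>A. \<Oplus>j\<in>B. f i j)"
    using insert by (intro finsum_insert) auto
  also have "\<dots> = (\<Oplus>j\<in>B. f a j \<oplus> (\<Oplus>i\<in>A. f i j))"
    using insert by (subst finsum_addf) auto
  also have "\<dots> = (\<Oplus>j\<in>B. \<Oplus>i\<in>insert a A. f i j)"
    using insert by (intro finsum_cong') (auto intro!: finsum_insert[symmetric] finsum_closed)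
  finally show ?case .
qed

lemma (in abelian_monoid) finsum_lessThan_Suc:
  assumes "\<And>i. i \<le> n \<Longrightarrow> f i \<in> carrier G"
  shows "finsum G f {..<Suc n} = finsum G f {..<n} \<oplus> f n"
proof -
  have "finsum G f (insert n {..<n}) = f n \<oplus> finsum G f {..<n}"
    using assms by (intro finsum_insert) auto
  then show ?thesis
    using assms by (simp add: lessThan_Suc a_comm finsum_closed Pi_def)
qed

lemma (in abelian_monoid) finsum_lessThan_add:
  fixes m n :: nat
  assumes "\<And>i. i < m + n \<Longrightarrow> f i \<in> carrier G"
  shows "finsum G f {..<m + n} = finsum G f {..<m} \<oplus> finsum G (\<lambda>i. f (m + i)) {..<n}"
  using assms
proof (induction n)
  case 0
  then show ?case by (simp add: finsum_closed Pi_def)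
next
  case (Suc n)
  have "finsum G f {..<m + Suc n} = finsum G f {..<m + n} \<oplus> f (m + n)"
    using finsum_lessThan_Suc[of "m + n" f] Suc.prems by simp
  also have "\<dots> = (finsum G f {..<m} \<oplus> finsum G (\<lambda>i. f (m + i)) {..<n}) \<oplus> f (m + n)"
    using Suc by simp
  also have "\<dots> = finsum G f {..<m} \<oplus> (finsum G (\<lambda>i. f (m + i)) {..<n} \<oplus> f (m + n))"
    using Suc.prems by (intro a_assoc) (auto intro!: finsum_closed)
  also have "finsum G (\<lambda>i. f (m + i)) {..<n} \<oplus> f (m + n) = finsum G (\<lambda>i. f (m + i)) {..<Suc n}"
    using Suc.prems by (subst finsum_lessThan_Suc) auto
  finally show ?case .
qed

lemma (in abelian_monoid) finsum_eq_single:
  assumes "a \<in> A" "finite A" "f a \<in> carrier G" "\<And>i. i \<in> A \<Longrightarrow> i \<noteq> a \<Longrightarrow> f i = \<zero>"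
  shows "finsum G f A = f a"
proof -
  have "finsum G f (insert a (A - {a})) = f a \<oplus> finsum G f (A - {a})"
    using assms by (intro finsum_insert) (auto simp: Pi_def)
  moreover have "finsum G f (A - {a}) = \<zero>"
    using assms by (intro add.finprod_one_eqI) auto
  moreover have "insert a (A - {a}) = A" using assms by auto
  ultimately show ?thesis using assms by simp
qed

section \<open>Matrix rings, commutants and block matrices\<close>

lemma mat_ring_simps:
  "carrier (mat_ring R n) = mats R n n" "x \<otimes>\<^bsub>mat_ring R n\<^esub> y = mat_mult R n x y"
  "\<one>\<^bsub>mat_ring R n\<^esub> = scalar_mat R n \<one>\<^bsub>R\<^esub>" "\<zero>\<^bsub>mat_ring R n\<^esub> = (\<lambda>_ _. \<zero>\<^bsub>R\<^esub>)"
  "x \<oplus>\<^bsub>mat_ring R n\<^esub> y = (\<lambda>i j. x i j \<oplus>\<^bsub>R\<^esub> y i j)"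
  by (simp_all add: mat_ring_def)

context ring
begin

lemma matsI:
  assumes "\<And>i j. i < m \<Longrightarrow> j < p \<Longrightarrow> x i j \<in> carrier R"
    and "\<And>i j. m \<le> i \<Longrightarrow> x i j = \<zero>" and "\<And>i j. p \<le> j \<Longrightarrow> x i j = \<zero>"
  shows "x \<in> mats R m p"
  using assms by (auto simp: mats_def not_less)

lemma mats_carrier: "x \<in> mats R m p \<Longrightarrow> x i j \<in> carrier R"
  by (cases "i < m \<and> j < p") (auto simp: mats_def)

lemma mats_row_zero: "x \<in> mats R m p \<Longrightarrow> m \<le> i \<Longrightarrow> x i j = \<zero>"
  and mats_col_zero: "x \<in> mats R m p \<Longrightarrow> p \<le> j \<Longrightarrow> x i j = \<zero>"
  by (auto simp: mats_def)

lemma mat_mult_closed [simp]: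
  assumes "x \<in> mats R m k" "y \<in> mats R k p"
  shows "mat_mult R k x y \<in> mats R m p"
  using assms[THEN mats_carrier] mats_row_zero[OF assms(1)] mats_col_zero[OF assms(2)]
  by (intro matsI) (auto simp: mat_mult_def intro!: finsum_closed add.finprod_one_eqI)

lemma mat_mult_assoc:
  assumes "x \<in> mats R m k" "y \<in> mats R k l" "z \<in> mats R l p"
  shows "mat_mult R l (mat_mult R k x y) z = mat_mult R k x (mat_mult R l y z)"
proof (intro ext)
  fix i j
  note [simp] = mats_carrier[OF assms(1)] mats_carrier[OF assms(2)] mats_carrier[OF assms(3)]
  have "mat_mult R l (mat_mult R k x y) z i j
      = (\<Oplus>a\<in>{..<l}. \<Oplus>b\<in>{..<k}. x i b \<otimes> y b a \<otimes> z a j)"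
    unfolding mat_mult_def by (intro finsum_cong') (auto simp: finsum_ldistr Pi_def)
  also have "\<dots> = (\<Oplus>b\<in>{..<k}. \<Oplus>a\<in>{..<l}. x i b \<otimes> y b a \<otimes> z a j)"
    by (rule finsum_swap) auto
  also have "\<dots> = mat_mult R k x (mat_mult R l y z) i j"
    unfolding mat_mult_def by (intro finsum_cong') (auto simp: finsum_rdistr Pi_def m_assoc)
  finally show "mat_mult R l (mat_mult R k x y) z i j = mat_mult R k x (mat_mult R l y z) i j" .
qed

lemma zero_mats [simp]: "(\<lambda>_ _. \<zero>) \<in> mats R m p"
  by (intro matsI) auto

lemma scalar_mats [simp]: "a \<in> carrier R \<Longrightarrow> scalar_mat R n a \<in> mats R n n"
  by (intro matsI) (auto simp: scalar_mat_def)

lemma add_mats [simp]: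
  assumes "x \<in> mats R m p" "y \<in> mats R m p"
  shows "(\<lambda>i j. x i j \<oplus> y i j) \<in> mats R m p"
  using assms[THEN mats_carrier] assms[THEN mats_row_zero] assms[THEN mats_col_zero]
  by (intro matsI) auto

lemma mat_mult_zero_left: "y \<in> mats R k p \<Longrightarrow> mat_mult R k (\<lambda>_ _. \<zero>) y = (\<lambda>_ _. \<zero>)"
  using mats_carrier by (fastforce simp: mat_mult_def intro!: ext add.finprod_one_eqI)

lemma mat_mult_zero_right: "x \<in> mats R m k \<Longrightarrow> mat_mult R k x (\<lambda>_ _. \<zero>) = (\<lambda>_ _. \<zero>)"
  using mats_carrier by (fastforce simp: mat_mult_def intro!: ext add.finprod_one_eqI)

lemma mat_mult_scalar_left:
  assumes "a \<in> carrier R" "x \<in> mats R n p"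
  shows "mat_mult R n (scalar_mat R n a) x = (\<lambda>i j. a \<otimes> x i j)"
proof (intro ext)
  fix i j
  note [simp] = assms mats_carrier[OF assms(2)]
  show "mat_mult R n (scalar_mat R n a) x i j = a \<otimes> x i j"
  proof (cases "i < n")
    case True
    then have "mat_mult R n (scalar_mat R n a) x i j = scalar_mat R n a i i \<otimes> x i j"
      unfolding mat_mult_def by (intro finsum_eq_single) (auto simp: scalar_mat_def)
    with True show ?thesis by (simp add: scalar_mat_def)
  next
    case False
    then have "mat_mult R n (scalar_mat R n a) x i j = \<zero>"
      unfolding mat_mult_def by (intro add.finprod_one_eqI) (auto simp: scalar_mat_def)
    with False show ?thesis by (simp add: mats_row_zero[OF assms(2)])
  qed
qed

lemma mat_mult_scalar_right:
  assumes "a \<in> carrier R" "x \<in> mats R m n"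
  shows "mat_mult R n x (scalar_mat R n a) = (\<lambda>i j. x i j \<otimes> a)"
proof (intro ext)
  fix i j
  note [simp] = assms mats_carrier[OF assms(2)]
  show "mat_mult R n x (scalar_mat R n a) i j = x i j \<otimes> a"
  proof (cases "j < n")
    case True
    then have "mat_mult R n x (scalar_mat R n a) i j = x i j \<otimes> scalar_mat R n a j j"
      unfolding mat_mult_def by (intro finsum_eq_single) (auto simp: scalar_mat_def)
    with True show ?thesis by (simp add: scalar_mat_def)
  next
    case False
    then have "mat_mult R n x (scalar_mat R n a) i j = \<zero>"
      unfolding mat_mult_def by (intro add.finprod_one_eqI) (auto simp: scalar_mat_def)
    with False show ?thesis by (simp add: mats_col_zero[OF assms(2)])
  qed
qed

lemma mat_mult_add_left:
  assumes "x \<in> mats R m k" "y \<in> mats R m k" "z \<in> mats R k p"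
  shows "mat_mult R k (\<lambda>i j. x i j \<oplus> y i j) z = (\<lambda>i j. mat_mult R k x z i j \<oplus> mat_mult R k y z i j)"
proof (intro ext)
  fix i j
  note [simp] = mats_carrier[OF assms(1)] mats_carrier[OF assms(2)] mats_carrier[OF assms(3)]
  show "mat_mult R k (\<lambda>i j. x i j \<oplus> y i j) z i j = mat_mult R k x z i j \<oplus> mat_mult R k y z i j"
    unfolding mat_mult_def
    by (subst finsum_addf[symmetric]) (auto simp: l_distr)
qed

lemma mat_mult_add_right:
  assumes "x \<in> mats R m k" "y \<in> mats R k p" "z \<in> mats R k p"
  shows "mat_mult R k x (\<lambda>i j. y i j \<oplus> z i j) = (\<lambda>i j. mat_mult R k x y i j \<oplus> mat_mult R k x z i j)"
proof (intro ext)
  fix i j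
  note [simp] = mats_carrier[OF assms(1)] mats_carrier[OF assms(2)] mats_carrier[OF assms(3)]
  show "mat_mult R k x (\<lambda>i j. y i j \<oplus> z i j) i j = mat_mult R k x y i j \<oplus> mat_mult R k x z i j"
    unfolding mat_mult_def
    by (subst finsum_addf[symmetric]) (auto simp: r_distr)
qed

lemma mat_ring_is_ring: "ring (mat_ring R n)"
proof (rule ringI)
  show "abelian_group (mat_ring R n)"
  proof (rule abelian_groupI)
    fix x assume "x \<in> carrier (mat_ring R n)"
    then have x: "x \<in> mats R n n" by (simp add: mat_ring_simps)
    then have "(\<lambda>i j. \<ominus> x i j) \<in> mats R n n"
      by (intro matsI) (auto simp: mats_row_zero[OF x] mats_col_zero[OF x] mats_carrier[OF x])
    moreover have "(\<lambda>i j. \<ominus> x i j \<oplus> x i j) = (\<lambda>_ _. \<zero>)"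
      by (simp add: l_neg mats_carrier[OF x])
    ultimately show "\<exists>y\<in>carrier (mat_ring R n). y \<oplus>\<^bsub>mat_ring R n\<^esub> x = \<zero>\<^bsub>mat_ring R n\<^esub>"
      by (auto simp: mat_ring_simps intro!: bexI[of _ "\<lambda>i j. \<ominus> x i j"])
  qed (auto simp: mat_ring_simps a_ac mats_carrier)
  show "monoid (mat_ring R n)"
    by (rule monoidI)
       (auto simp: mat_ring_simps mat_mult_scalar_left mat_mult_scalar_right mats_carrier
          intro!: mat_mult_assoc)
qed (auto simp: mat_ring_simps mat_mult_add_left mat_mult_add_right)

lemma commutant_is_ring:
  assumes "a \<in> carrier R"
  shows "ring (commutant R a)"
proof -
  have "subring {b \<in> carrier R. a \<otimes> b = b \<otimes> a} R"
  proof (rule subringI)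
    fix h k assume hk: "h \<in> {b \<in> carrier R. a \<otimes> b = b \<otimes> a}" "k \<in> {b \<in> carrier R. a \<otimes> b = b \<otimes> a}"
    then show "h \<oplus> k \<in> {b \<in> carrier R. a \<otimes> b = b \<otimes> a}"
      using assms by (auto simp: l_distr r_distr)
    have "a \<otimes> (h \<otimes> k) = h \<otimes> (a \<otimes> k)"
      using hk assms by (metis (mono_tags, lifting) m_assoc mem_Collect_eq)
    then show "h \<otimes> k \<in> {b \<in> carrier R. a \<otimes> b = b \<otimes> a}"
      using hk assms by (auto simp: m_assoc)
  qed (use assms in \<open>auto simp: l_minus r_minus\<close>)
  then show ?thesis
    unfolding commutant_def by (rule subring_is_ring)
qed

text \<open>Only the cut points m (rows) and p (columns) are recorded. Blocks from the matching
  \<open>mats\<close> vanish outside their ranges, so the outer sizes stay implicit and rectangular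
  blocks are covered.\<close>

definition block_mat where
  "block_mat m p a b c d = (\<lambda>i j.
     if i < m then if j < p then a i j else b i (j - p)
     else if j < p then c (i - m) j else d (i - m) (j - p))"

lemma mat_dsum_eq_block_mat:
  "mat_dsum R m x y = block_mat m m x (\<lambda>_ _. \<zero>) (\<lambda>_ _. \<zero>) y"
  by (auto simp: mat_dsum_def block_mat_def intro!: ext)

lemma block_mat_closed [simp]:
  assumes "a \<in> mats R m p" "b \<in> mats R m q" "c \<in> mats R n p" "d \<in> mats R n q"
  shows "block_mat m p a b c d \<in> mats R (m + n) (p + q)"
  using assms[THEN mats_carrier] assms[THEN mats_row_zero] assms[THEN mats_col_zero]
  by (intro matsI) (auto simp: block_mat_def)

lemma block_mat_mult:
  assumes "a \<in> mats R m p" "b \<in> mats R m q" "c \<in> mats R n p" "d \<in> mats R n q"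
    and "a' \<in> mats R p r" "b' \<in> mats R p s" "c' \<in> mats R q r" "d' \<in> mats R q s"
  shows "mat_mult R (p + q) (block_mat m p a b c d) (block_mat p r a' b' c' d') =
    block_mat m r
      (\<lambda>i j. mat_mult R p a a' i j \<oplus> mat_mult R q b c' i j)
      (\<lambda>i j. mat_mult R p a b' i j \<oplus> mat_mult R q b d' i j)
      (\<lambda>i j. mat_mult R p c a' i j \<oplus> mat_mult R q d c' i j)
      (\<lambda>i j. mat_mult R p c b' i j \<oplus> mat_mult R q d d' i j)"
proof (intro ext)
  fix i j
  note [simp] = assms[THEN mats_carrier]
  have C: "block_mat m p a b c d i l \<in> carrier R" "block_mat p r a' b' c' d' l j \<in> carrier R" for l
    by (auto simp: block_mat_def)
  show "mat_mult R (p + q) (block_mat m p a b c d) (block_mat p r a' b' c' d') i j =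
    block_mat m r
      (\<lambda>i j. mat_mult R p a a' i j \<oplus> mat_mult R q b c' i j)
      (\<lambda>i j. mat_mult R p a b' i j \<oplus> mat_mult R q b d' i j)
      (\<lambda>i j. mat_mult R p c a' i j \<oplus> mat_mult R q d c' i j)
      (\<lambda>i j. mat_mult R p c b' i j \<oplus> mat_mult R q d d' i j) i j"
    unfolding mat_mult_def
    by (subst finsum_lessThan_add)
       (auto simp: C block_mat_def intro!: arg_cong2[where f = "(\<oplus>)"] finsum_cong')
qed

lemma mat_dsum_closed [simp]:
  "x \<in> mats R m m \<Longrightarrow> y \<in> mats R n n \<Longrightarrow> mat_dsum R m x y \<in> mats R (m + n) (m + n)"
  by (simp add: mat_dsum_eq_block_mat)

end

section \<open>$K_0$ and traces\<close>

context ring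
begin

lemma idempotentsD:
  assumes "(m, e) \<in> idempotents R"
  shows "e \<in> mats R m m" "mat_mult R m e e = e"
  using assms by (auto simp: idempotents_def)

lemma alg_equivI:
  assumes "(m, e) \<in> idempotents R" "(p, f) \<in> idempotents R"
    and "x \<in> mats R m p" "y \<in> mats R p m" "mat_mult R p x y = e" "mat_mult R m y x = f"
  shows "((m, e), (p, f)) \<in> alg_equiv R"
  using assms by (auto simp: alg_equiv_def)

lemma alg_equivE:
  assumes "((m, e), (p, f)) \<in> alg_equiv R"
  obtains x y where "(m, e) \<in> idempotents R" "(p, f) \<in> idempotents R"
    "x \<in> mats R m p" "y \<in> mats R p m" "mat_mult R p x y = e" "mat_mult R m y x = f"
  using assms by (auto simp: alg_equiv_def)

text \<open>The composite witnesses are x z and w y: (x z)(w y) = x f y = (x y)(x y) = e, because z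
  w = f = y x, and likewise (w y)(x z) = g. Idempotence of e and g makes up for witnesses that need
  not satisfy e x = x = x f.\<close>

lemma alg_equiv_trans:
  assumes "((m, e), (p, f)) \<in> alg_equiv R" "((p, f), (q, g)) \<in> alg_equiv R"
  shows "((m, e), (q, g)) \<in> alg_equiv R"
proof -
  obtain x y where e: "(m, e) \<in> idempotents R" and f: "(p, f) \<in> idempotents R"
    and x: "x \<in> mats R m p" and y: "y \<in> mats R p m"
    and xy: "mat_mult R p x y = e" and yx: "mat_mult R m y x = f"
    using assms(1) by (rule alg_equivE)
  obtain z w where g: "(q, g) \<in> idempotents R"
    and z: "z \<in> mats R p q" and w: "w \<in> mats R q p"
    and zw: "mat_mult R q z w = f" and wz: "mat_mult R p w z = g"
    using assms(2) by (rule alg_equivE)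
  have xz: "mat_mult R p x z \<in> mats R m q" and wy: "mat_mult R p w y \<in> mats R q m"
    using x y z w by auto
  note assoc = mat_mult_assoc[OF xz w y] mat_mult_assoc[OF x z w] mat_mult_assoc[OF x y x]
    mat_mult_assoc[OF _ x y, of e m] mat_mult_assoc[OF wy x z] mat_mult_assoc[OF w y x]
    mat_mult_assoc[OF w z w] mat_mult_assoc[OF _ w z, of g q]
  note E = idempotentsD[OF e] and G = idempotentsD[OF g]
  have 1: "mat_mult R q (mat_mult R p x z) (mat_mult R p w y) = e"
    using assoc(1-4) E by (simp add: zw xy yx)
  have 2: "mat_mult R m (mat_mult R p w y) (mat_mult R p x z) = g"
    using assoc(5-8) G by (simp add: zw wz yx)
  show ?thesis
    by (rule alg_equivI[OF e g xz wy 1 2])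
qed

lemma equiv_alg_equiv: "equiv (idempotents R) (alg_equiv R)"
proof (rule equivI)
  show "alg_equiv R \<subseteq> idempotents R \<times> idempotents R"
    by (auto simp: alg_equiv_def)
  show "refl_on (idempotents R) (alg_equiv R)"
    by (rule refl_onI) (auto intro!: alg_equivI dest: idempotentsD)
  show "sym (alg_equiv R)"
    by (rule symI) (auto simp: alg_equiv_def)
  show "trans (alg_equiv R)"
    by (rule transI) (auto intro: alg_equiv_trans)
qed

text \<open>The blocks are rectangular because the factors witnessing an equivalence change the
  size.\<close>

lemma mat_dsum_mult:
  assumes "x \<in> mats R m p" "y \<in> mats R p r" "x' \<in> mats R n q" "y' \<in> mats R q s"
  shows "mat_mult R (p + q) (block_mat m p x (\<lambda>_ _. \<zero>) (\<lambda>_ _. \<zero>) x')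
      (block_mat p r y (\<lambda>_ _. \<zero>) (\<lambda>_ _. \<zero>) y') =
    block_mat m r (mat_mult R p x y) (\<lambda>_ _. \<zero>) (\<lambda>_ _. \<zero>) (mat_mult R q x' y')"
proof -
  have c: "mat_mult R p x y \<in> mats R m r" "mat_mult R q x' y' \<in> mats R n s"
    using assms by auto
  have "mat_mult R (p + q) (block_mat m p x (\<lambda>_ _. \<zero>) (\<lambda>_ _. \<zero>) x')
      (block_mat p r y (\<lambda>_ _. \<zero>) (\<lambda>_ _. \<zero>) y') =
    block_mat m r
      (\<lambda>i j. mat_mult R p x y i j \<oplus> mat_mult R q (\<lambda>_ _. \<zero>) (\<lambda>_ _. \<zero>) i j)
      (\<lambda>i j. mat_mult R p x (\<lambda>_ _. \<zero>) i j \<oplus> mat_mult R q (\<lambda>_ _. \<zero>) y' i j)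
      (\<lambda>i j. mat_mult R p (\<lambda>_ _. \<zero>) y i j \<oplus> mat_mult R q x' (\<lambda>_ _. \<zero>) i j)
      (\<lambda>i j. mat_mult R p (\<lambda>_ _. \<zero>) (\<lambda>_ _. \<zero>) i j \<oplus> mat_mult R q x' y' i j)"
    by (rule block_mat_mult) (use assms in auto)
  then show ?thesis
    using c[THEN mats_carrier]
    by (simp add: mat_mult_zero_left[OF assms(2)] mat_mult_zero_left[OF assms(4)]
          mat_mult_zero_right[OF assms(1)] mat_mult_zero_right[OF assms(3)]
          mat_mult_zero_left[OF zero_mats])
qed

lemma mat_dsum_idempotent:
  assumes "(m, e) \<in> idempotents R" "(p, f) \<in> idempotents R"
  shows "(m + p, mat_dsum R m e f) \<in> idempotents R"
  using idempotentsD[OF assms(1)] idempotentsD[OF assms(2)]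
  by (auto simp: idempotents_def mat_dsum_eq_block_mat mat_dsum_mult)

lemma mat_dsum_alg_equiv:
  assumes "((m, e), (m', e')) \<in> alg_equiv R" "((p, f), (p', f')) \<in> alg_equiv R"
  shows "((m + p, mat_dsum R m e f), (m' + p', mat_dsum R m' e' f')) \<in> alg_equiv R"
proof -
  obtain x y where e: "(m, e) \<in> idempotents R" "(m', e') \<in> idempotents R"
    and x: "x \<in> mats R m m'" and y: "y \<in> mats R m' m"
    and xy: "mat_mult R m' x y = e" and yx: "mat_mult R m y x = e'"
    using assms(1) by (rule alg_equivE)
  obtain z w where f: "(p, f) \<in> idempotents R" "(p', f') \<in> idempotents R"
    and z: "z \<in> mats R p p'" and w: "w \<in> mats R p' p"
    and zw: "mat_mult R p' z w = f" and wz: "mat_mult R p w z = f'"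
    using assms(2) by (rule alg_equivE)
  show ?thesis
  proof (rule alg_equivI)
    show "block_mat m m' x (\<lambda>_ _. \<zero>) (\<lambda>_ _. \<zero>) z \<in> mats R (m + p) (m' + p')"
      "block_mat m' m y (\<lambda>_ _. \<zero>) (\<lambda>_ _. \<zero>) w \<in> mats R (m' + p') (m + p)"
      using x y z w by auto
  qed (use e f x y z w xy yx zw wz in
        \<open>auto simp: mat_dsum_mult mat_dsum_eq_block_mat[symmetric] intro: mat_dsum_idempotent\<close>)
qed

text \<open>The witnesses are block swaps with e and f in place of identity blocks. Their products
  have e e and f f on the diagonal, which are e and f again.\<close>

lemma mat_dsum_commute_alg_equiv:
  assumes "(m, e) \<in> idempotents R" "(p, f) \<in> idempotents R"
  shows "((m + p, mat_dsum R m e f), (p + m, mat_dsum R p f e)) \<in> alg_equiv R"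
proof (rule alg_equivI)
  let ?Z = "\<lambda>_ _. \<zero>"
  note e = idempotentsD[OF assms(1)] and f = idempotentsD[OF assms(2)]
  note [simp] = e f e(1)[THEN mats_carrier] f(1)[THEN mats_carrier] mat_mult_zero_left[OF zero_mats]
    mat_mult_zero_left[OF e(1)] mat_mult_zero_right[OF e(1)]
    mat_mult_zero_left[OF f(1)] mat_mult_zero_right[OF f(1)]
  show "block_mat m p ?Z e f ?Z \<in> mats R (m + p) (p + m)"
    "block_mat p m ?Z f e ?Z \<in> mats R (p + m) (m + p)"
    by auto
  have "mat_mult R (p + m) (block_mat m p ?Z e f ?Z) (block_mat p m ?Z f e ?Z) =
    block_mat m m
      (\<lambda>i j. mat_mult R p ?Z ?Z i j \<oplus> mat_mult R m e e i j)
      (\<lambda>i j. mat_mult R p ?Z f i j \<oplus> mat_mult R m e ?Z i j)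
      (\<lambda>i j. mat_mult R p f ?Z i j \<oplus> mat_mult R m ?Z e i j)
      (\<lambda>i j. mat_mult R p f f i j \<oplus> mat_mult R m ?Z ?Z i j)"
    by (rule block_mat_mult) (rule e f zero_mats)+
  then show "mat_mult R (p + m) (block_mat m p ?Z e f ?Z) (block_mat p m ?Z f e ?Z) = mat_dsum R m
      e f"
    by (simp add: mat_dsum_eq_block_mat)
  have "mat_mult R (m + p) (block_mat p m ?Z f e ?Z) (block_mat m p ?Z e f ?Z) =
    block_mat p p
      (\<lambda>i j. mat_mult R m ?Z ?Z i j \<oplus> mat_mult R p f f i j)
      (\<lambda>i j. mat_mult R m ?Z e i j \<oplus> mat_mult R p f ?Z i j)
      (\<lambda>i j. mat_mult R m e ?Z i j \<oplus> mat_mult R p ?Z f i j)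
      (\<lambda>i j. mat_mult R m e e i j \<oplus> mat_mult R p ?Z ?Z i j)"
    by (rule block_mat_mult) (rule e f zero_mats)+
  then show "mat_mult R (m + p) (block_mat p m ?Z f e ?Z) (block_mat m p ?Z e f ?Z) = mat_dsum R p
      f e"
    by (simp add: mat_dsum_eq_block_mat)
qed (use assms in \<open>auto intro: mat_dsum_idempotent\<close>)

lemma zero_idempotent: "(0, \<lambda>_ _. \<zero>) \<in> idempotents R"
  by (auto simp: idempotents_def mat_mult_zero_left[OF zero_mats])

text \<open>The product in \<open>V_monoid\<close> is a union over all representatives. By
  \<open>mat_dsum_alg_equiv\<close> the united classes all coincide, so any one choice of
  representatives computes it.\<close>

lemma V_monoid_mult:
  assumes "(m, e) \<in> idempotents R" "(p, f) \<in> idempotents R"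
  shows "alg_equiv R `` {(m, e)} \<otimes>\<^bsub>V_monoid R\<^esub> alg_equiv R `` {(p, f)}
    = alg_equiv R `` {(m + p, mat_dsum R m e f)}"
proof -
  have "alg_equiv R `` {(m' + p', mat_dsum R m' e' f')} = alg_equiv R `` {(m + p, mat_dsum R m e
      f)}"
    if "((m, e), (m', e')) \<in> alg_equiv R" "((p, f), (p', f')) \<in> alg_equiv R" for m' e' p' f'
    using mat_dsum_alg_equiv[OF that] equiv_class_eq[OF equiv_alg_equiv] by metis
  moreover have "((m, e), (m, e)) \<in> alg_equiv R" "((p, f), (p, f)) \<in> alg_equiv R"
    using assms equiv_class_self[OF equiv_alg_equiv] by auto
  ultimately show ?thesis
    unfolding V_monoid_def monoid.simps by fastforce
qed

lemma V_monoid_carrierE: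
  assumes "X \<in> carrier (V_monoid R)"
  obtains m e where "(m, e) \<in> idempotents R" "X = alg_equiv R `` {(m, e)}"
  using assms by (auto simp: V_monoid_def elim!: quotientE)

lemma V_monoid_carrierI:
  "(m, e) \<in> idempotents R \<Longrightarrow> alg_equiv R `` {(m, e)} \<in> carrier (V_monoid R)"
  by (auto simp: V_monoid_def intro: quotientI)

lemma mat_dsum_assoc:
  "mat_dsum R (m + p) (mat_dsum R m e f) g = mat_dsum R m e (mat_dsum R p f g)"
  by (intro ext) (auto simp: mat_dsum_def)

lemma mat_dsum_zero_left: "mat_dsum R 0 z e = e"
  by (intro ext) (auto simp: mat_dsum_def)

lemma V_monoid_comm_monoid: "comm_monoid (V_monoid R)"
proof (rule comm_monoidI)
  have one: "\<one>\<^bsub>V_monoid R\<^esub> = alg_equiv R `` {(0, \<lambda>_ _. \<zero>)}"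
    by (simp add: V_monoid_def)
  show "\<one>\<^bsub>V_monoid R\<^esub> \<in> carrier (V_monoid R)"
    unfolding one by (rule V_monoid_carrierI[OF zero_idempotent])
  fix X assume "X \<in> carrier (V_monoid R)"
  then obtain m e where e: "(m, e) \<in> idempotents R" and X: "X = alg_equiv R `` {(m, e)}"
    by (rule V_monoid_carrierE)
  show "\<one>\<^bsub>V_monoid R\<^esub> \<otimes>\<^bsub>V_monoid R\<^esub> X = X"
    unfolding one X V_monoid_mult[OF zero_idempotent e] by (simp add: mat_dsum_zero_left)
  fix Y assume "Y \<in> carrier (V_monoid R)"
  then obtain p f where f: "(p, f) \<in> idempotents R" and Y: "Y = alg_equiv R `` {(p, f)}"
    by (rule V_monoid_carrierE)
  show "X \<otimes>\<^bsub>V_monoid R\<^esub> Y \<in> carrier (V_monoid R)"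
    unfolding X Y V_monoid_mult[OF e f]
    by (rule V_monoid_carrierI[OF mat_dsum_idempotent[OF e f]])
  show "X \<otimes>\<^bsub>V_monoid R\<^esub> Y = Y \<otimes>\<^bsub>V_monoid R\<^esub> X"
    unfolding X Y V_monoid_mult[OF e f] V_monoid_mult[OF f e]
    by (rule equiv_class_eq[OF equiv_alg_equiv mat_dsum_commute_alg_equiv[OF e f]])
  fix Z assume "Z \<in> carrier (V_monoid R)"
  then obtain q g where g: "(q, g) \<in> idempotents R" and Z: "Z = alg_equiv R `` {(q, g)}"
    by (rule V_monoid_carrierE)
  show "X \<otimes>\<^bsub>V_monoid R\<^esub> Y \<otimes>\<^bsub>V_monoid R\<^esub> Z = X \<otimes>\<^bsub>V_monoid R\<^esub> (Y \<otimes>\<^bsub>V_monoid R\<^esub> Z)"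
    unfolding X Y Z V_monoid_mult[OF e f] V_monoid_mult[OF f g]
      V_monoid_mult[OF mat_dsum_idempotent[OF e f] g] V_monoid_mult[OF e mat_dsum_idempotent[OF f
          g]]
    by (simp add: mat_dsum_assoc add.assoc)
qed

end

section \<open>The Grothendieck group of a commutative monoid and its universal property\<close>

context comm_monoid
begin

lemma equiv_grothendieck_rel: "equiv (carrier G \<times> carrier G) (grothendieck_rel G)"
proof (rule equivI)
  show "grothendieck_rel G \<subseteq> (carrier G \<times> carrier G) \<times> (carrier G \<times> carrier G)"
    by (auto simp: grothendieck_rel_def)
  show "refl_on (carrier G \<times> carrier G) (grothendieck_rel G)"
    by (rule refl_onI) (auto simp: grothendieck_rel_def)
  show "sym (grothendieck_rel G)"
    unfolding sym_def grothendieck_rel_def by (clarsimp, metis)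
  show "trans (grothendieck_rel G)"
  proof (rule transI, clarify)
    fix a b c d e f
    assume "((a, b), (c, d)) \<in> grothendieck_rel G" "((c, d), (e, f)) \<in> grothendieck_rel G"
    then obtain k l where c: "a \<in> carrier G" "b \<in> carrier G" "c \<in> carrier G" "d \<in> carrier G"
        "e \<in> carrier G" "f \<in> carrier G" "k \<in> carrier G" "l \<in> carrier G"
      and k: "a \<otimes> d \<otimes> k = c \<otimes> b \<otimes> k" and l: "c \<otimes> f \<otimes> l = e \<otimes> d \<otimes> l"
      by (auto simp: grothendieck_rel_def)
    \<comment> \<open>Without cancellation in G the middle element d cannot be removed, so it is
      absorbed into the auxiliary factor d k l.\<close>
    have "a \<otimes> f \<otimes> (d \<otimes> k \<otimes> l) = (a \<otimes> d \<otimes> k) \<otimes> (f \<otimes> l)"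
      using c by (simp add: m_ac)
    also have "\<dots> = (c \<otimes> f \<otimes> l) \<otimes> (b \<otimes> k)"
      unfolding k using c by (simp add: m_ac)
    also have "\<dots> = e \<otimes> b \<otimes> (d \<otimes> k \<otimes> l)"
      unfolding l using c by (simp add: m_ac)
    finally show "((a, b), (e, f)) \<in> grothendieck_rel G"
      using c by (auto simp: grothendieck_rel_def intro!: bexI[of _ "d \<otimes> k \<otimes> l"])
  qed
qed

lemma grothendieck_group_mult:
  assumes "a \<in> carrier G" "b \<in> carrier G" "c \<in> carrier G" "d \<in> carrier G"
  shows "grothendieck_rel G `` {(a, b)} \<otimes>\<^bsub>grothendieck_group G\<^esub> grothendieck_rel G `` {(c, d)}
    = grothendieck_rel G `` {(a \<otimes> c, b \<otimes> d)}"
proof -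
  have "grothendieck_rel G `` {(a' \<otimes> c', b' \<otimes> d')} = grothendieck_rel G `` {(a \<otimes> c, b \<otimes> d)}"
    if ab: "((a, b), (a', b')) \<in> grothendieck_rel G" and cd: "((c, d), (c', d')) \<in>
        grothendieck_rel G"
    for a' b' c' d'
  proof (rule equiv_class_eq[OF equiv_grothendieck_rel, symmetric])
    obtain k l where cl: "a' \<in> carrier G" "b' \<in> carrier G" "c' \<in> carrier G" "d' \<in> carrier G"
        "k \<in> carrier G" "l \<in> carrier G"
      and k: "a \<otimes> b' \<otimes> k = a' \<otimes> b \<otimes> k" and l: "c \<otimes> d' \<otimes> l = c' \<otimes> d \<otimes> l"
      using ab cd by (auto simp: grothendieck_rel_def)
    have "(a \<otimes> c) \<otimes> (b' \<otimes> d') \<otimes> (k \<otimes> l) = (a \<otimes> b' \<otimes> k) \<otimes> (c \<otimes> d' \<otimes> l)"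
      using cl assms by (simp add: m_ac)
    also have "\<dots> = (a' \<otimes> c') \<otimes> (b \<otimes> d) \<otimes> (k \<otimes> l)"
      unfolding k l using cl assms by (simp add: m_ac)
    finally show "((a \<otimes> c, b \<otimes> d), (a' \<otimes> c', b' \<otimes> d')) \<in> grothendieck_rel G"
      using cl assms by (auto simp: grothendieck_rel_def)
  qed
  moreover have "((a, b), (a, b)) \<in> grothendieck_rel G" "((c, d), (c, d)) \<in> grothendieck_rel G"
    using assms equiv_class_self[OF equiv_grothendieck_rel] by auto
  ultimately show ?thesis
    unfolding grothendieck_group_def monoid.simps by fastforce
qed

lemma grothendieck_group_carrierI:
  "a \<in> carrier G \<Longrightarrow> b \<in> carrier G \<Longrightarrow>
    grothendieck_rel G `` {(a, b)} \<in> carrier (grothendieck_group G)"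
  by (auto simp: grothendieck_group_def intro: quotientI)

lemma grothendieck_group_carrierE:
  assumes "X \<in> carrier (grothendieck_group G)"
  obtains a b where "a \<in> carrier G" "b \<in> carrier G" "X = grothendieck_rel G `` {(a, b)}"
  using assms by (auto simp: grothendieck_group_def elim!: quotientE)

lemma grothendieck_group_mult_closed:
  assumes "X \<in> carrier (grothendieck_group G)" "Y \<in> carrier (grothendieck_group G)"
  shows "X \<otimes>\<^bsub>grothendieck_group G\<^esub> Y \<in> carrier (grothendieck_group G)"
  using assms
  by (elim grothendieck_group_carrierE)
     (auto simp: grothendieck_group_mult intro!: grothendieck_group_carrierI)

text \<open>The universal property. The value is read off a chosen representative pair; it is
  independent of the choice since the image of the auxiliary factor k can be cancelled in the group
  H.\<close>

lemma grothendieck_group_lift: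
  assumes "comm_group H" and h: "h \<in> hom G H"
  obtains \<tau> where "\<tau> \<in> hom (grothendieck_group G) H"
    and "\<And>a b. a \<in> carrier G \<Longrightarrow> b \<in> carrier G \<Longrightarrow>
      \<tau> (grothendieck_rel G `` {(a, b)}) = h a \<otimes>\<^bsub>H\<^esub> inv\<^bsub>H\<^esub> h b"
proof
  interpret H: comm_group H by fact
  have hc: "h a \<in> carrier H" if "a \<in> carrier G" for a
    using h that by (auto simp: hom_def)
  have hm: "h (a \<otimes> b) = h a \<otimes>\<^bsub>H\<^esub> h b" if "a \<in> carrier G" "b \<in> carrier G" for a b
    using h that by (auto simp: hom_def)
  define \<tau> where "\<tau> X = (case SOME p. p \<in> X of (a, b) \<Rightarrow> h a \<otimes>\<^bsub>H\<^esub> inv\<^bsub>H\<^esub> h b)" for X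
  show \<tau>: "\<tau> (grothendieck_rel G `` {(a, b)}) = h a \<otimes>\<^bsub>H\<^esub> inv\<^bsub>H\<^esub> h b"
    if ab: "a \<in> carrier G" "b \<in> carrier G" for a b
  proof -
    have "(SOME p. p \<in> grothendieck_rel G `` {(a, b)}) \<in> grothendieck_rel G `` {(a, b)}"
      by (rule someI_ex) (use ab equiv_class_self[OF equiv_grothendieck_rel] in auto)
    then obtain c d where cd: "(SOME p. p \<in> grothendieck_rel G `` {(a, b)}) = (c, d)"
      and "((a, b), (c, d)) \<in> grothendieck_rel G"
      by (cases "SOME p. p \<in> grothendieck_rel G `` {(a, b)}") auto
    then obtain k where c: "c \<in> carrier G" "d \<in> carrier G" "k \<in> carrier G"
      and k: "a \<otimes> d \<otimes> k = c \<otimes> b \<otimes> k"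
      by (auto simp: grothendieck_rel_def)
    have "h a \<otimes>\<^bsub>H\<^esub> h d \<otimes>\<^bsub>H\<^esub> h k = h c \<otimes>\<^bsub>H\<^esub> h b \<otimes>\<^bsub>H\<^esub> h k"
      using k ab c by (metis hm m_closed)
    then have *: "h a \<otimes>\<^bsub>H\<^esub> h d = h c \<otimes>\<^bsub>H\<^esub> h b"
      using ab c hc by simp
    have "h c \<otimes>\<^bsub>H\<^esub> inv\<^bsub>H\<^esub> h d = (h c \<otimes>\<^bsub>H\<^esub> h b) \<otimes>\<^bsub>H\<^esub> (inv\<^bsub>H\<^esub> h b \<otimes>\<^bsub>H\<^esub> inv\<^bsub>H\<^esub> h d)"
      using ab c hc by (simp add: H.m_assoc) (metis H.inv_closed H.m_assoc H.r_inv H.l_one)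
    also have "\<dots> = (h a \<otimes>\<^bsub>H\<^esub> h d) \<otimes>\<^bsub>H\<^esub> (inv\<^bsub>H\<^esub> h d \<otimes>\<^bsub>H\<^esub> inv\<^bsub>H\<^esub> h b)"
      using ab c hc by (simp add: * H.m_comm)
    also have "\<dots> = h a \<otimes>\<^bsub>H\<^esub> inv\<^bsub>H\<^esub> h b"
      using ab c hc by (simp add: H.m_assoc) (metis H.inv_closed H.m_assoc H.r_inv H.l_one)
    finally show ?thesis unfolding \<tau>_def cd by simp
  qed
  show "\<tau> \<in> hom (grothendieck_group G) H"
  proof (rule homI)
    fix X assume "X \<in> carrier (grothendieck_group G)"
    then obtain a b where ab: "a \<in> carrier G" "b \<in> carrier G" and X: "X = grothendieck_rel G ``
        {(a, b)}"
      by (rule grothendieck_group_carrierE)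
    show "\<tau> X \<in> carrier H" unfolding X \<tau>[OF ab] using ab hc by simp
    fix Y assume "Y \<in> carrier (grothendieck_group G)"
    then obtain c d where cd: "c \<in> carrier G" "d \<in> carrier G" and Y: "Y = grothendieck_rel G ``
        {(c, d)}"
      by (rule grothendieck_group_carrierE)
    show "\<tau> (X \<otimes>\<^bsub>grothendieck_group G\<^esub> Y) = \<tau> X \<otimes>\<^bsub>H\<^esub> \<tau> Y"
      unfolding X Y grothendieck_group_mult[OF ab cd]
      using ab cd hc by (simp add: \<tau> hm H.inv_mult H.m_ac)
  qed
qed

end

section \<open>Homomorphisms from \<open>K0\<close> given by traces\<close>

context ring
begin

lemma finsum_hom:
  fixes n :: nat
  assumes "abelian_group_hom R S t" "\<And>i. i < n \<Longrightarrow> f i \<in> carrier R"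
  shows "t (finsum R f {..<n}) = (\<Oplus>\<^bsub>S\<^esub>i\<in>{..<n}. t (f i))"
proof -
  interpret t: abelian_group_hom R S t by fact
  show ?thesis
    using assms(2)
  proof (induction n)
    case (Suc n)
    have "t (finsum R f {..<Suc n}) = t (finsum R f {..<n}) \<oplus>\<^bsub>S\<^esub> t (f n)"
      using Suc.prems by (subst finsum_lessThan_Suc) (auto simp: Pi_def finsum_closed)
    also have "\<dots> = (\<Oplus>\<^bsub>S\<^esub>i\<in>{..<Suc n}. t (f i))"
      using Suc by (subst t.H.finsum_lessThan_Suc) auto
    finally show ?case .
  qed simp
qed

text \<open>Summing the trace property over all entries gives x y and y x the same trace even for
  rectangular x and y, so the trace of an idempotent is constant on algebraic equivalence classes.
  It is additive on direct sums and extends to \<open>K0\<close> by the universal property.\<close>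

lemma K0_trace:
  assumes t: "abelian_group_hom R S t"
    and tr: "\<And>x y. x \<in> carrier R \<Longrightarrow> y \<in> carrier R \<Longrightarrow> t (x \<otimes> y) = t (y \<otimes> x)"
  obtains \<tau> where "\<tau> \<in> hom (K0 R) (add_monoid S)"
    and "\<And>m e. (m, e) \<in> idempotents R \<Longrightarrow> \<tau> (K0_class R m e) = (\<Oplus>\<^bsub>S\<^esub>i\<in>{..<m}. t (e i i))"
proof -
  interpret t: abelian_group_hom R S t by fact
  interpret V: comm_monoid "V_monoid R" by (rule V_monoid_comm_monoid)
  define T where "T = (\<lambda>(m :: nat, e). \<Oplus>\<^bsub>S\<^esub>i\<in>{..<m}. t (e i i))"
  have T_equiv: "T (m, e) = T (p, f)" if "((m, e), (p, f)) \<in> alg_equiv R" for m e p f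
  proof -
    obtain x y where x: "x \<in> mats R m p" and y: "y \<in> mats R p m"
      and xy: "mat_mult R p x y = e" and yx: "mat_mult R m y x = f"
      using \<open>((m, e), (p, f)) \<in> alg_equiv R\<close> by (rule alg_equivE)
    note [simp] = mats_carrier[OF x] mats_carrier[OF y]
    have "T (m, e) = (\<Oplus>\<^bsub>S\<^esub>i\<in>{..<m}. \<Oplus>\<^bsub>S\<^esub>j\<in>{..<p}. t (x i j \<otimes> y j i))"
      unfolding T_def xy[symmetric] mat_mult_def by (simp add: finsum_hom[OF t])
    also have "\<dots> = (\<Oplus>\<^bsub>S\<^esub>j\<in>{..<p}. \<Oplus>\<^bsub>S\<^esub>i\<in>{..<m}. t (y j i \<otimes> x i j))"
      by (subst t.H.finsum_swap) (auto simp: tr)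
    also have "\<dots> = T (p, f)"
      unfolding T_def yx[symmetric] mat_mult_def by (simp add: finsum_hom[OF t])
    finally show ?thesis .
  qed
  have T_dsum: "T (m + p, mat_dsum R m e f) = T (m, e) \<oplus>\<^bsub>S\<^esub> T (p, f)"
    if "(m, e) \<in> idempotents R" "(p, f) \<in> idempotents R" for m e p f
  proof -
    note [simp] = idempotentsD(1)[OF that(1), THEN mats_carrier] idempotentsD(1)[OF that(2), THEN
        mats_carrier]
    show ?thesis
      unfolding T_def prod.case
      by (subst t.H.finsum_lessThan_add)
         (auto simp: mat_dsum_def intro!: arg_cong2[where f = "(\<oplus>\<^bsub>S\<^esub>)"] t.H.finsum_cong')
  qed
  define T' where "T' X = T (SOME p. p \<in> X)" for X
  have T': "T' (alg_equiv R `` {(m, e)}) = T (m, e)" if "(m, e) \<in> idempotents R" for m e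
  proof -
    have "(SOME p. p \<in> alg_equiv R `` {(m, e)}) \<in> alg_equiv R `` {(m, e)}"
      by (rule someI_ex) (use that equiv_class_self[OF equiv_alg_equiv] in auto)
    then obtain p f where "(SOME p. p \<in> alg_equiv R `` {(m, e)}) = (p, f)" "((m, e), (p, f)) \<in>
        alg_equiv R"
      by (cases "SOME p. p \<in> alg_equiv R `` {(m, e)}") auto
    then show ?thesis
      unfolding T'_def using T_equiv[of m e p f] by simp
  qed
  have T_closed: "T (m, e) \<in> carrier S" if "(m, e) \<in> idempotents R" for m e
    unfolding T_def using idempotentsD(1)[OF that, THEN mats_carrier]
    by (auto intro!: t.H.finsum_closed)
  have "T' \<in> hom (V_monoid R) (add_monoid S)"
  proof (rule homI)
    fix X assume "X \<in> carrier (V_monoid R)"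
    then obtain m e where e: "(m, e) \<in> idempotents R" and X: "X = alg_equiv R `` {(m, e)}"
      by (rule V_monoid_carrierE)
    show "T' X \<in> carrier (add_monoid S)" unfolding X T'[OF e] by (simp add: T_closed[OF e])
    fix Y assume "Y \<in> carrier (V_monoid R)"
    then obtain p f where f: "(p, f) \<in> idempotents R" and Y: "Y = alg_equiv R `` {(p, f)}"
      by (rule V_monoid_carrierE)
    show "T' (X \<otimes>\<^bsub>V_monoid R\<^esub> Y) = T' X \<otimes>\<^bsub>add_monoid S\<^esub> T' Y"
      unfolding X Y V_monoid_mult[OF e f] T'[OF e] T'[OF f] T'[OF mat_dsum_idempotent[OF e f]]
      by (simp add: T_dsum[OF e f])
  qed
  then obtain \<tau> where \<tau>: "\<tau> \<in> hom (K0 R) (add_monoid S)"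
    and \<tau>_eq: "\<And>a b. a \<in> carrier (V_monoid R) \<Longrightarrow> b \<in> carrier (V_monoid R) \<Longrightarrow>
      \<tau> (grothendieck_rel (V_monoid R) `` {(a, b)}) = T' a \<otimes>\<^bsub>add_monoid S\<^esub> inv\<^bsub>add_monoid S\<^esub> T' b"
    unfolding K0_def by (rule V.grothendieck_group_lift[OF t.H.a_comm_group]) blast
  show ?thesis
  proof
    fix m e assume e: "(m, e) \<in> idempotents R"
    \<comment> \<open>\<open>K0_class\<close> is the formal difference of the class of e and that of
      the empty idempotent, whose trace is an empty sum.\<close>
    have "T' \<one>\<^bsub>V_monoid R\<^esub> = \<zero>\<^bsub>S\<^esub>"
      using T'[OF zero_idempotent] by (simp add: V_monoid_def T_def)
    moreover have "inv\<^bsub>add_monoid S\<^esub> \<zero>\<^bsub>S\<^esub> = \<zero>\<^bsub>S\<^esub>"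
      using monoid.inv_one[OF group.is_monoid[OF comm_group.axioms(2)[OF t.H.a_comm_group]]] by simp
    ultimately show "\<tau> (K0_class R m e) = (\<Oplus>\<^bsub>S\<^esub>i\<in>{..<m}. t (e i i))"
      unfolding K0_class_def \<tau>_eq[OF V_monoid_carrierI[OF e] V.one_closed] T'[OF e]
      using T_closed[OF e] by (simp add: T_def)
  qed (fact \<tau>)
qed

lemma K0_mult_closed:
  "X \<in> carrier (K0 R) \<Longrightarrow> Y \<in> carrier (K0 R) \<Longrightarrow> X \<otimes>\<^bsub>K0 R\<^esub> Y \<in> carrier (K0 R)"
  unfolding K0_def by (rule comm_monoid.grothendieck_group_mult_closed[OF V_monoid_comm_monoid])

lemma K0_class_closed: "(m, e) \<in> idempotents R \<Longrightarrow> K0_class R m e \<in> carrier (K0 R)"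
  unfolding K0_def K0_class_def
  using comm_monoid.grothendieck_group_carrierI[OF V_monoid_comm_monoid]
    V_monoid_carrierI monoid.one_closed comm_monoid.axioms(1)[OF V_monoid_comm_monoid]
  by metis

end

section \<open>Intertwiners of triangular matrices\<close>

lemma (in abelian_monoid) finsum_eq_pair:
  assumes "a \<in> A" "b \<in> A" "a \<noteq> b" "finite A" "f a \<in> carrier G" "f b \<in> carrier G"
    and "\<And>i. i \<in> A \<Longrightarrow> i \<noteq> a \<Longrightarrow> i \<noteq> b \<Longrightarrow> f i = \<zero>"
  shows "finsum G f A = f a \<oplus> f b"
proof -
  have "finsum G f (insert a (A - {a})) = f a \<oplus> finsum G f (A - {a})"
    using assms by (intro finsum_insert) (auto simp: Pi_def, metis zero_closed)
  moreover have "finsum G f (A - {a}) = f b"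
    using assms by (intro finsum_eq_single) auto
  moreover have "insert a (A - {a}) = A" using assms by auto
  ultimately show ?thesis by simp
qed

text \<open>The ring need not be commutative. The factorisation 1 - x x = (1 - x)(1 + x) = (1 + x)(1
  - x) yields a left inverse w (1 + x) and a right inverse (1 + x) w of 1 - x, which therefore
  coincide.\<close>

lemma (in ring) one_minus_Units:
  assumes x: "x \<in> carrier R" and "\<one> \<ominus> x \<otimes> x \<in> Units R"
  shows "\<one> \<ominus> x \<in> Units R"
proof -
  obtain w where w: "w \<in> carrier R" "w \<otimes> (\<one> \<ominus> x \<otimes> x) = \<one>" "(\<one> \<ominus> x \<otimes> x) \<otimes> w = \<one>"
    using assms by (auto simp: Units_def)
  have c: "\<one> \<ominus> x \<in> carrier R" "\<one> \<oplus> x \<in> carrier R"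
    using x by auto
  have 1: "(\<one> \<ominus> x) \<otimes> (\<one> \<oplus> x) = \<one> \<ominus> x \<otimes> x" and 2: "(\<one> \<oplus> x) \<otimes> (\<one> \<ominus> x) = \<one> \<ominus> x \<otimes> x"
    using x by (simp_all add: r_distr l_distr minus_eq l_minus r_minus a_assoc minus_add r_neg1
        r_neg2)
  have r: "(\<one> \<ominus> x) \<otimes> ((\<one> \<oplus> x) \<otimes> w) = \<one>"
    using m_assoc[OF c w(1)] w(3) by (simp only: 1)
  have l: "(w \<otimes> (\<one> \<oplus> x)) \<otimes> (\<one> \<ominus> x) = \<one>"
    using m_assoc[OF w(1) c(2) c(1)] w(2) by (simp only: 2)
  have "w \<otimes> (\<one> \<oplus> x) = (\<one> \<oplus> x) \<otimes> w"
    by (rule inv_unique[OF l r]) (use w c in auto)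
  with l r show ?thesis
    unfolding Units_def using w(1) c by (intro CollectI conjI bexI[of _ "(\<one> \<oplus> x) \<otimes> w"]) (auto simp
        only: m_closed)
qed

section \<open>Inverses of triangular matrices\<close>

context ring
begin

lemma mat_ring_minus:
  assumes "x \<in> mats R n n" "y \<in> mats R n n"
  shows "x \<ominus>\<^bsub>mat_ring R n\<^esub> y = (\<lambda>i j. x i j \<ominus> y i j)"
proof -
  interpret M: ring "mat_ring R n" by (rule mat_ring_is_ring)
  have "(\<lambda>i j. \<ominus> y i j) \<in> mats R n n"
    using mats_carrier[OF assms(2)] mats_row_zero[OF assms(2)] mats_col_zero[OF assms(2)]
    by (intro matsI) auto
  then have "\<ominus>\<^bsub>mat_ring R n\<^esub> y = (\<lambda>i j. \<ominus> y i j)"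
    using assms mats_carrier[OF assms(2)]
    by (intro M.minus_equality) (auto simp: mat_ring_simps l_neg)
  then show ?thesis
    by (simp add: a_minus_def mat_ring_simps)
qed

text \<open>Doubling s replaces the geometric series: if x lives on and above the s-th
  superdiagonal, then x x lives on and above the 2s-th, so 1 - x x is invertible by induction and
  \<open>one_minus_Units\<close> applies. For s at least n, x is zero.\<close>

lemma strictly_upper_Units:
  assumes "x \<in> mats R n n" "s > 0" "\<And>i j. j < i + s \<Longrightarrow> x i j = \<zero>"
  shows "\<one>\<^bsub>mat_ring R n\<^esub> \<ominus>\<^bsub>mat_ring R n\<^esub> x \<in> Units (mat_ring R n)"
  using assms
proof (induction "n - s" arbitrary: s x rule: less_induct)
  case less
  interpret M: ring "mat_ring R n" by (rule mat_ring_is_ring)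
  note [simp] = mats_carrier[OF less.prems(1)]
  show ?case
  proof (cases "s < n")
    case True
    have "mat_mult R n x x \<in> mats R n n"
      using less.prems by simp
    moreover have "mat_mult R n x x i j = \<zero>" if "j < i + 2 * s" for i j
      unfolding mat_mult_def
    proof (rule add.finprod_one_eqI)
      fix l
      \<comment> \<open>If l < i + s the first factor vanishes; otherwise j < i + 2 s, which is at
        most l + s, and the second one does.\<close>
      show "x i l \<otimes> x l j = \<zero>"
        using less.prems(3)[of l i] less.prems(3)[of j l] that by (cases "l < i + s") auto
    qed
    ultimately have "\<one>\<^bsub>mat_ring R n\<^esub> \<ominus>\<^bsub>mat_ring R n\<^esub> mat_mult R n x x \<in> Units (mat_ring R n)"
      using less.prems(2) True by (intro less.hyps[of "2 * s"]) auto
    then show ?thesis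
      using M.one_minus_Units[of x] less.prems(1) by (simp add: mat_ring_simps)
  next
    case False
    have "x i j = \<zero>" for i j
      using less.prems(3)[of j i] False mats_col_zero[OF less.prems(1), of j i] by (cases "j < n")
          auto
    then have "x = \<zero>\<^bsub>mat_ring R n\<^esub>"
      by (auto simp: mat_ring_simps intro!: ext)
    then show ?thesis by (simp add: M.minus_eq)
  qed
qed

text \<open>Normalise the diagonal: E inverts the diagonal part D of u, so E u = 1 - x with x
  strictly upper triangular, which is the case s = 1 above, and u = D (E u).\<close>

lemma upper_triangular_Units:
  assumes u: "u \<in> mats R n n" and upper: "\<And>i j. j < i \<Longrightarrow> u i j = \<zero>"
    and diag: "\<And>i. i < n \<Longrightarrow> u i i \<in> Units R"
  shows "u \<in> Units (mat_ring R n)"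
proof -
  interpret M: ring "mat_ring R n" by (rule mat_ring_is_ring)
  define E where "E = (\<lambda>i j. if i = j \<and> i < n then inv (u i i) else \<zero>)"
  define D where "D = (\<lambda>i j. if i = j \<and> i < n then u i i else \<zero>)"
  note [simp] = mats_carrier[OF u]
  have E: "E \<in> mats R n n" and D: "D \<in> mats R n n"
    using diag by (auto simp: E_def D_def intro!: matsI)
  have diag_mult: "mat_mult R n (\<lambda>i j. if i = j \<and> i < n then d i else \<zero>) x = (\<lambda>i j. if i < n then
      d i \<otimes> x i j else \<zero>)"
    if d: "\<And>i. i < n \<Longrightarrow> d i \<in> carrier R" and x: "x \<in> mats R n n" for d x
  proof (intro ext)
    fix i j
    show "mat_mult R n (\<lambda>i j. if i = j \<and> i < n then d i else \<zero>) x i j = (if i < n then d i \<otimes> x i j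
        else \<zero>)"
      unfolding mat_mult_def
      using d mats_carrier[OF x]
      by (cases "i < n", subst finsum_eq_single[of i]) (auto intro!: add.finprod_one_eqI)
  qed
  have "mat_mult R n E D = scalar_mat R n \<one>" "mat_mult R n D E = scalar_mat R n \<one>"
    using diag diag_mult[of "\<lambda>i. inv (u i i)" D] diag_mult[of "\<lambda>i. u i i" E] E D
    by (auto simp: E_def[symmetric] D_def[symmetric])
       (auto simp: E_def D_def scalar_mat_def intro!: ext)
  then have EU: "E \<in> Units (mat_ring R n)" "D \<in> Units (mat_ring R n)"
    and DE: "D \<otimes>\<^bsub>mat_ring R n\<^esub> E = \<one>\<^bsub>mat_ring R n\<^esub>"
    using E D by (auto simp: Units_def mat_ring_simps)
  have Eu: "mat_mult R n E u = (\<lambda>i j. if i < n then inv (u i i) \<otimes> u i j else \<zero>)"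
    using diag diag_mult[of "\<lambda>i. inv (u i i)" u] u by (simp add: E_def)
  define x where "x = \<one>\<^bsub>mat_ring R n\<^esub> \<ominus>\<^bsub>mat_ring R n\<^esub> mat_mult R n E u"
  have x: "x = (\<lambda>i j. scalar_mat R n \<one> i j \<ominus> mat_mult R n E u i j)"
    unfolding x_def using E u by (subst mat_ring_minus) (auto simp: mat_ring_simps)
  have "\<one>\<^bsub>mat_ring R n\<^esub> \<ominus>\<^bsub>mat_ring R n\<^esub> x \<in> Units (mat_ring R n)"
  proof (rule strictly_upper_Units)
    show "x \<in> mats R n n"
      using M.minus_closed[of "\<one>\<^bsub>mat_ring R n\<^esub>" "mat_mult R n E u"] E u
      unfolding x_def by (simp add: mat_ring_simps)
    fix i j :: nat assume "j < i + 1"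
    then show "x i j = \<zero>"
      using diag upper by (cases "i = j") (auto simp: x Eu scalar_mat_def minus_eq r_neg)
  qed simp
  moreover have Euc: "mat_mult R n E u \<in> carrier (mat_ring R n)"
    using E u by (simp add: mat_ring_simps)
  then have "\<one>\<^bsub>mat_ring R n\<^esub> \<ominus>\<^bsub>mat_ring R n\<^esub> x = mat_mult R n E u"
    unfolding x_def by (simp add: M.minus_eq M.minus_add M.a_assoc[symmetric] M.r_neg)
  ultimately have "D \<otimes>\<^bsub>mat_ring R n\<^esub> mat_mult R n E u \<in> Units (mat_ring R n)"
    using EU by (intro M.Units_m_closed) auto
  moreover have "D \<otimes>\<^bsub>mat_ring R n\<^esub> mat_mult R n E u = u"
  proof -
    have "D \<otimes>\<^bsub>mat_ring R n\<^esub> (E \<otimes>\<^bsub>mat_ring R n\<^esub> u) = u"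
      using DE E D u by (subst M.m_assoc[symmetric]) (auto simp: mat_ring_simps
          mat_mult_scalar_left)
    then show ?thesis by (simp add: mat_ring_simps)
  qed
  ultimately show ?thesis by simp
qed

section \<open>Block decompositions, and ring elements as 1 by 1 matrices\<close>

lemma block_mat_inject:
  assumes "a \<in> mats R m p" "b \<in> mats R m q" "c \<in> mats R n p" "d \<in> mats R n q"
    and "a' \<in> mats R m p" "b' \<in> mats R m q" "c' \<in> mats R n p" "d' \<in> mats R n q"
    and eq: "block_mat m p a b c d = block_mat m p a' b' c' d'"
  shows "a = a'" "b = b'" "c = c'" "d = d'"
proof -
  have E: "block_mat m p a b c d i j = block_mat m p a' b' c' d' i j" for i j
    using eq by simp
  show "a = a'"
  proof (intro ext)
    fix i j show "a i j = a' i j"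
      using E[of i j] assms(1,5) by (cases "i < m \<and> j < p") (auto simp: block_mat_def mats_def)
  qed
  show "b = b'"
  proof (intro ext)
    fix i j show "b i j = b' i j"
      using E[of i "p + j"] assms(2,6) by (cases "i < m") (auto simp: block_mat_def mats_def)
  qed
  show "c = c'"
  proof (intro ext)
    fix i j show "c i j = c' i j"
      using E[of "m + i" j] assms(3,7) by (cases "j < p") (auto simp: block_mat_def mats_def)
  qed
  show "d = d'"
  proof (intro ext)
    fix i j show "d i j = d' i j"
      using E[of "m + i" "p + j"] by (auto simp: block_mat_def)
  qed
qed

lemma block_matE:
  assumes "x \<in> mats R (m + n) (p + q)"
  obtains a b c d where "a \<in> mats R m p" "b \<in> mats R m q" "c \<in> mats R n p" "d \<in> mats R n q"
    "x = block_mat m p a b c d"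
proof
  note [simp] = mats_carrier[OF assms]
  show "(\<lambda>i j. if i < m \<and> j < p then x i j else \<zero>) \<in> mats R m p"
    "(\<lambda>i j. if i < m then x i (p + j) else \<zero>) \<in> mats R m q"
    "(\<lambda>i j. if j < p then x (m + i) j else \<zero>) \<in> mats R n p"
    "(\<lambda>i j. x (m + i) (p + j)) \<in> mats R n q"
    using mats_row_zero[OF assms] mats_col_zero[OF assms] by (auto intro!: matsI)
  show "x = block_mat m p (\<lambda>i j. if i < m \<and> j < p then x i j else \<zero>)
     (\<lambda>i j. if i < m then x i (p + j) else \<zero>)
     (\<lambda>i j. if j < p then x (m + i) j else \<zero>) (\<lambda>i j. x (m + i) (p + j))"
    by (intro ext) (auto simp: block_mat_def)
qed

text \<open>In this way the two projections, which are elements of the commutant, enter its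
  \<open>K0\<close>.\<close>

lemma scalar_idempotent:
  assumes "p \<in> carrier R" "p \<otimes> p = p"
  shows "(1, scalar_mat R 1 p) \<in> idempotents R"
proof -
  have "mat_mult R 1 (scalar_mat R 1 p) (scalar_mat R 1 p) = (\<lambda>i j. p \<otimes> scalar_mat R 1 p i j)"
    by (rule mat_mult_scalar_left[OF assms(1) scalar_mats[OF assms(1)]])
  also have "\<dots> = scalar_mat R 1 p"
    using assms(2) assms(1)[THEN r_null] by (auto simp: scalar_mat_def intro!: ext)
  finally show ?thesis
    using assms by (simp add: idempotents_def)
qed

end

context cring
begin

text \<open>The last clause is the algebraic form of full support: superdiagonal entries are not
  zero divisors. It lets the argument from equal \<open>K0\<close> classes to similarity run over
  any reduced commutative ring.\<close>

definition regular_triangular :: "nat \<Rightarrow> (nat \<Rightarrow> nat \<Rightarrow> 'a) \<Rightarrow> bool" where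
  "regular_triangular n A \<longleftrightarrow> A \<in> mats R n n \<and> (\<forall>k l. l < k \<longrightarrow> A k l = \<zero>) \<and>
     (\<forall>k l. k < n \<longrightarrow> l < n \<longrightarrow> A k k = A l l) \<and>
     (\<forall>k. k + 1 < n \<longrightarrow> (\<forall>r\<in>carrier R. A k (k + 1) \<otimes> r = \<zero> \<longrightarrow> r = \<zero>))"

lemma regular_triangularD:
  assumes "regular_triangular n A"
  shows "A \<in> mats R n n" "l < k \<Longrightarrow> A k l = \<zero>" "k < n \<Longrightarrow> l < n \<Longrightarrow> A k k = A l l"
    "k + 1 < n \<Longrightarrow> r \<in> carrier R \<Longrightarrow> A k (k + 1) \<otimes> r = \<zero> \<Longrightarrow> r = \<zero>"
  using assms unfolding regular_triangular_def by blast+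

section \<open>Solutions u of A u = u B\<close>

context
  fixes n A B
  assumes reduced: "\<And>r. r \<in> carrier R \<Longrightarrow> r \<otimes> r = \<zero> \<Longrightarrow> r = \<zero>"
    and A: "regular_triangular n A" and B: "regular_triangular n B"
begin

context
  fixes u
  assumes u: "u \<in> mats R n n" and Au: "mat_mult R n A u = mat_mult R n u B"
begin

private lemma carriers: "u i j \<in> carrier R" "A i j \<in> carrier R" "B i j \<in> carrier R"
  using mats_carrier[OF u] mats_carrier[OF regular_triangularD(1)[OF A]]
    mats_carrier[OF regular_triangularD(1)[OF B]] by auto

private lemma intertwiner_entry:
  "(\<Oplus>l\<in>{..<n}. A i l \<otimes> u l j) = (\<Oplus>l\<in>{..<n}. u i l \<otimes> B l j)"
  using fun_cong[OF fun_cong[OF Au, of i], of j] by (simp add: mat_mult_def)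

text \<open>With \<open>d\<close> the difference of the two diagonal values, the rows from the bottom up and the
  columns from left to right successively give \<open>d\<^sup>2 u\<^sub>i\<^sub>j = 0\<close>, and \<open>d u\<^sub>i\<^sub>j = 0\<close> because the ring is reduced.\<close>

lemma intertwiner_diagonals:
  assumes "i < n" "j < n"
  shows "A i i \<otimes> u i j = u i j \<otimes> B j j"
  using assms
proof (induction "2 * (n - i) + j" arbitrary: i j rule: less_induct)
  case less
  note [simp] = carriers
  \<comment> \<open>Both diagonals are constant, so d is the same at all positions. Entries settled
    earlier in the induction are annihilated by this very d, and multiplying the (i, j) equation by
    d leaves one term on each side.\<close>
  define d where "d = A i i \<ominus> B j j"
  have d[simp]: "d \<in> carrier R" by (simp add: d_def)
  have du: "d \<otimes> u k l = A k k \<otimes> u k l \<ominus> u k l \<otimes> B l l" if "k < n" "l < n" for k l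
  proof -
    have eq: "A i i = A k k" "B j j = B l l"
      using regular_triangularD(3)[OF A less.prems(1) that(1)]
        regular_triangularD(3)[OF B less.prems(2) that(2)] by auto
    show ?thesis
      unfolding d_def eq by (simp add: m_comm[of _ "u k l"] r_distr minus_eq r_minus)
  qed
  have diff: "d \<otimes> u k l = \<zero>" if "k < n" "l < n" "A k k \<otimes> u k l = u k l \<otimes> B l l" for k l
    using du[OF that(1,2)] that(3) by simp
  have "d \<otimes> (\<Oplus>l\<in>{..<n}. A i l \<otimes> u l j) = (\<Oplus>l\<in>{..<n}. d \<otimes> (A i l \<otimes> u l j))"
    by (simp add: finsum_rdistr Pi_def)
  also have "\<dots> = d \<otimes> (A i i \<otimes> u i j)"
  proof (rule finsum_eq_single)
    fix l assume l: "l \<in> {..<n}" "l \<noteq> i"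
    show "d \<otimes> (A i l \<otimes> u l j) = \<zero>"
    proof (cases "l < i")
      case True
      then show ?thesis using regular_triangularD(2)[OF A] by simp
    next
      case False
      then have "d \<otimes> u l j = \<zero>"
        using l less.prems by (intro diff less.hyps) auto
      then show ?thesis using m_lcomm[of d "A i l" "u l j"] by simp
    qed
  qed (use less.prems in auto)
  finally have 1: "d \<otimes> (\<Oplus>l\<in>{..<n}. A i l \<otimes> u l j) = d \<otimes> (A i i \<otimes> u i j)" .
  have "d \<otimes> (\<Oplus>l\<in>{..<n}. u i l \<otimes> B l j) = (\<Oplus>l\<in>{..<n}. d \<otimes> (u i l \<otimes> B l j))"
    by (simp add: finsum_rdistr Pi_def)
  also have "\<dots> = d \<otimes> (u i j \<otimes> B j j)"
  proof (rule finsum_eq_single)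
    fix l assume l: "l \<in> {..<n}" "l \<noteq> j"
    show "d \<otimes> (u i l \<otimes> B l j) = \<zero>"
    proof (cases "j < l")
      case True
      then show ?thesis using regular_triangularD(2)[OF B] by simp
    next
      case False
      then have "d \<otimes> u i l = \<zero>"
        using l less.prems by (intro diff less.hyps) auto
      then show ?thesis by (simp add: m_assoc[symmetric])
    qed
  qed (use less.prems in auto)
  finally have "d \<otimes> (A i i \<otimes> u i j) = d \<otimes> (u i j \<otimes> B j j)"
    using 1 intertwiner_entry[of i j] by simp
  then have "d \<otimes> (d \<otimes> u i j) = \<zero>"
    using less.prems by (simp add: du minus_eq r_distr r_minus r_neg)
  moreover have "(d \<otimes> u i j) \<otimes> (d \<otimes> u i j) = u i j \<otimes> (d \<otimes> (d \<otimes> u i j))"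
    by (simp add: m_ac)
  ultimately have "d \<otimes> u i j = \<zero>" using reduced[of "d \<otimes> u i j"] by simp
  then show ?case using less.prems by (simp add: du)
qed

text \<open>Entry (i, j) is read off the equation at (i, j + 1), a column that exists since j < i <
  n. By induction it reduces to \<open>A i i * u i (j+1) = u i j * B j (j+1) + u i (j+1) * B (j+1)
  (j+1)\<close>. The terms with \<open>u i (j+1)\<close> cancel by
  \<open>intertwiner_diagonals\<close>, and \<open>B j (j+1)\<close> is not a zero divisor. The
  weight counts rows twice because the entries (l, j + 1) with l > i lie one column to the right and
  must still come earlier.\<close>

lemma intertwiner_upper: "j < i \<Longrightarrow> u i j = \<zero>"
proof (induction "2 * (n - i) + j" arbitrary: i j rule: less_induct)
  case less
  note [simp] = carriers
  show ?case
  proof (cases "i < n")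
    case True
    have "(\<Oplus>l\<in>{..<n}. A i l \<otimes> u l (j + 1)) = A i i \<otimes> u i (j + 1)"
    proof (rule finsum_eq_single)
      fix l assume l: "l \<in> {..<n}" "l \<noteq> i"
      show "A i l \<otimes> u l (j + 1) = \<zero>"
      proof (cases "l < i")
        case True
        then show ?thesis using regular_triangularD(2)[OF A] by simp
      next
        case False
        then have "u l (j + 1) = \<zero>"
          using l less.prems by (intro less.hyps) auto
        then show ?thesis by simp
      qed
    qed (use True in auto)
    moreover have "(\<Oplus>l\<in>{..<n}. u i l \<otimes> B l (j + 1)) = u i j \<otimes> B j (j + 1) \<oplus> u i (j + 1) \<otimes> B (j +
        1) (j + 1)"
    proof (rule finsum_eq_pair)
      fix l assume l: "l \<in> {..<n}" "l \<noteq> j" "l \<noteq> j + 1"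
      show "u i l \<otimes> B l (j + 1) = \<zero>"
      proof (cases "j + 1 < l")
        case True
        then show ?thesis using regular_triangularD(2)[OF B] by simp
      next
        case False
        then have "u i l = \<zero>"
          using l less.prems True by (intro less.hyps) auto
        then show ?thesis by simp
      qed
    qed (use True less.prems in auto)
    ultimately have "u i j \<otimes> B j (j + 1) \<oplus> u i (j + 1) \<otimes> B (j + 1) (j + 1) = u i (j + 1) \<otimes> B (j +
        1) (j + 1)"
      using intertwiner_entry[of i "j + 1"] intertwiner_diagonals[of i "j + 1"] True less.prems by
          simp
    then have "B j (j + 1) \<otimes> u i j = \<zero>"
      by (simp add: m_comm[of "B j (Suc j)"])
    then show ?thesis
      using regular_triangularD(4)[OF B, of j "u i j"] True less.prems by simp
  next
    case False
    then show ?thesis using mats_row_zero[OF u] by simp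
  qed
qed

text \<open>In the equation at (k, k + 1) triangularity leaves two terms on each side, and those
  with \<open>u k (k+1)\<close> cancel by \<open>intertwiner_diagonals\<close>. The result is a
  recursion along the diagonal of u.\<close>

lemma intertwiner_diag:
  assumes "k + 1 < n"
  shows "A k (k + 1) \<otimes> u (k + 1) (k + 1) = u k k \<otimes> B k (k + 1)"
proof -
  note [simp] = carriers
  have "(\<Oplus>l\<in>{..<n}. A k l \<otimes> u l (k + 1)) = A k k \<otimes> u k (k + 1) \<oplus> A k (k + 1) \<otimes> u (k + 1) (k + 1)"
  proof (rule finsum_eq_pair)
    fix l assume "l \<noteq> k" "l \<noteq> k + 1"
    then show "A k l \<otimes> u l (k + 1) = \<zero>"
      using regular_triangularD(2)[OF A, of l k] intertwiner_upper[of "k + 1" l] by (cases "l <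
          k") auto
  qed (use assms in auto)
  moreover have "(\<Oplus>l\<in>{..<n}. u k l \<otimes> B l (k + 1)) = u k k \<otimes> B k (k + 1) \<oplus> u k (k + 1) \<otimes> B (k + 1)
      (k + 1)"
  proof (rule finsum_eq_pair)
    fix l assume "l \<noteq> k" "l \<noteq> k + 1"
    then show "u k l \<otimes> B l (k + 1) = \<zero>"
      using regular_triangularD(2)[OF B, of "k + 1" l] intertwiner_upper[of l k] by (cases "l <
          k") auto
  qed (use assms in auto)
  ultimately have "A k (k + 1) \<otimes> u (k + 1) (k + 1) \<oplus> u k (k + 1) \<otimes> B (k + 1) (k + 1) =
      u k k \<otimes> B k (k + 1) \<oplus> u k (k + 1) \<otimes> B (k + 1) (k + 1)"
    using intertwiner_entry[of k "k + 1"] intertwiner_diagonals[of k "k + 1"] assms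
    by (simp add: a_comm)
  then show ?thesis by simp
qed

end

text \<open>By \<open>intertwiner_diag\<close> the diagonals of u and v obey the same first-order
  recursion, so the cross products agree inductively once \<open>A k (k+1)\<close> is cancelled.
  Cross-multiplication avoids dividing by entries not yet known to be invertible.\<close>

lemma intertwiners_diag_ratio:
  assumes "u \<in> mats R n n" "mat_mult R n A u = mat_mult R n u B"
    and "v \<in> mats R n n" "mat_mult R n A v = mat_mult R n v B"
    and "k < n"
  shows "u k k \<otimes> v 0 0 = v k k \<otimes> u 0 0"
  using \<open>k < n\<close>
proof (induction k)
  case 0
  then show ?case using mats_carrier[OF assms(1)] mats_carrier[OF assms(3)] by (simp add: m_comm)
next
  case (Suc k)
  note [simp] = mats_carrier[OF assms(1)] mats_carrier[OF assms(3)]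
    mats_carrier[OF regular_triangularD(1)[OF A]] mats_carrier[OF regular_triangularD(1)[OF B]]
  have k: "k + 1 < n" using Suc.prems by simp
  have "A k (k + 1) \<otimes> (u (k + 1) (k + 1) \<otimes> v 0 0) = u k k \<otimes> B k (k + 1) \<otimes> v 0 0"
    unfolding intertwiner_diag[OF assms(1,2) k, symmetric] by (rule m_assoc[symmetric]) auto
  also have "\<dots> = (u k k \<otimes> v 0 0) \<otimes> B k (k + 1)"
    by (simp add: m_ac)
  also have "\<dots> = v k k \<otimes> B k (k + 1) \<otimes> u 0 0"
    unfolding Suc.IH[OF Suc_lessD[OF Suc.prems]] by (simp add: m_ac)
  also have "\<dots> = A k (k + 1) \<otimes> (v (k + 1) (k + 1) \<otimes> u 0 0)"
    unfolding intertwiner_diag[OF assms(3,4) k, symmetric] by (rule m_assoc) auto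
  finally have "A k (k + 1) \<otimes> (u (k + 1) (k + 1) \<otimes> v 0 0 \<ominus> v (k + 1) (k + 1) \<otimes> u 0 0) = \<zero>"
    by (simp add: minus_eq r_distr r_minus r_neg)
  then have "u (k + 1) (k + 1) \<otimes> v 0 0 \<ominus> v (k + 1) (k + 1) \<otimes> u 0 0 = \<zero>"
    by (rule regular_triangularD(4)[OF A k, rotated]) auto
  then show ?case by simp
qed

end

end

section \<open>The commutant of a direct sum\<close>

lemma commutant_simps:
  "carrier (commutant R a) = {b \<in> carrier R. a \<otimes>\<^bsub>R\<^esub> b = b \<otimes>\<^bsub>R\<^esub> a}"
  "x \<otimes>\<^bsub>commutant R a\<^esub> y = x \<otimes>\<^bsub>R\<^esub> y" "x \<oplus>\<^bsub>commutant R a\<^esub> y = x \<oplus>\<^bsub>R\<^esub> y"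
  "\<one>\<^bsub>commutant R a\<^esub> = \<one>\<^bsub>R\<^esub>" "\<zero>\<^bsub>commutant R a\<^esub> = \<zero>\<^bsub>R\<^esub>"
  by (simp_all add: commutant_def)

lemma abelian_group_hom_ringI:
  assumes "ring R" "ring S" "\<And>x. x \<in> carrier R \<Longrightarrow> t x \<in> carrier S"
    and "\<And>x y. x \<in> carrier R \<Longrightarrow> y \<in> carrier R \<Longrightarrow> t (x \<oplus>\<^bsub>R\<^esub> y) = t x \<oplus>\<^bsub>S\<^esub> t y"
  shows "abelian_group_hom R S t"
proof -
  interpret R: ring R by fact
  interpret S: ring S by fact
  show ?thesis
    by (intro abelian_group_homI group_hom.intro group_hom_axioms.intro homI
          R.abelian_group_axioms S.abelian_group_axioms R.a_group S.a_group)
       (simp_all add: assms)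
qed

lemma (in ring) K0_trace_scalar:
  assumes "abelian_group_hom R S t" "p \<in> carrier R"
  shows "(\<Oplus>\<^bsub>S\<^esub>i\<in>{..<1::nat}. t (scalar_mat R 1 p i i)) = t p"
proof -
  interpret t: abelian_group_hom R S t by fact
  have "(\<Oplus>\<^bsub>S\<^esub>i\<in>{..<1::nat}. t (scalar_mat R 1 p i i)) = t (scalar_mat R 1 p 0 0)"
    by (rule t.H.finsum_eq_single) (use assms in \<open>auto simp: scalar_mat_def\<close>)
  then show ?thesis by (simp add: scalar_mat_def)
qed

context cring
begin

abbreviation dsum_commutant where
  "dsum_commutant n A B \<equiv> commutant (mat_ring R (2 * n)) (mat_dsum R n A B)"

abbreviation proj1 where "proj1 n \<equiv> mat_dsum R n (scalar_mat R n \<one>) (\<lambda>_ _. \<zero>)"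
abbreviation proj2 where "proj2 n \<equiv> mat_dsum R n (\<lambda>_ _. \<zero>) (scalar_mat R n \<one>)"

lemma dsum_commutant_ring:
  assumes "A \<in> mats R n n" "B \<in> mats R n n"
  shows "ring (dsum_commutant n A B)"
  using mat_dsum_closed[OF assms]
  by (intro ring.commutant_is_ring mat_ring_is_ring) (simp add: mat_ring_simps mult_2)

lemma dsum_commutant_carrier:
  "c \<in> carrier (dsum_commutant n A B) \<longleftrightarrow> c \<in> mats R (n + n) (n + n) \<and>
     mat_mult R (n + n) (mat_dsum R n A B) c = mat_mult R (n + n) c (mat_dsum R n A B)"
  by (simp add: commutant_simps mat_ring_simps mult_2)

text \<open>Compare the four blocks of the two products. Each block is an intertwiner between two of
  the summands, so the results on A u = u B apply to all four.\<close>

lemma dsum_commutant_blocksE: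
  assumes A: "A \<in> mats R n n" and B: "B \<in> mats R n n"
    and C: "C \<in> carrier (dsum_commutant n A B)"
  obtains a b c d where "a \<in> mats R n n" "b \<in> mats R n n" "c \<in> mats R n n" "d \<in> mats R n n"
    "C = block_mat n n a b c d"
    "mat_mult R n A a = mat_mult R n a A" "mat_mult R n A b = mat_mult R n b B"
    "mat_mult R n B c = mat_mult R n c A" "mat_mult R n B d = mat_mult R n d B"
proof -
  let ?Z = "\<lambda>_ _. \<zero>"
  have "C \<in> mats R (n + n) (n + n)"
    using C by (simp add: dsum_commutant_carrier)
  then obtain a b c d where abcd: "a \<in> mats R n n" "b \<in> mats R n n" "c \<in> mats R n n" "d \<in> mats R n
      n"
    and C_eq: "C = block_mat n n a b c d"
    by (rule block_matE)
  have m: "mat_mult R n x y i j \<in> carrier R" if "x \<in> mats R n n" "y \<in> mats R n n" for x y i j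
    by (rule mats_carrier[OF mat_mult_closed[OF that]])
  note z = mat_mult_zero_left[OF abcd(1)] mat_mult_zero_left[OF abcd(2)] mat_mult_zero_left[OF
      abcd(3)]
    mat_mult_zero_left[OF abcd(4)] mat_mult_zero_right[OF abcd(1)] mat_mult_zero_right[OF abcd(2)]
    mat_mult_zero_right[OF abcd(3)] mat_mult_zero_right[OF abcd(4)]
  have "mat_mult R (n + n) (mat_dsum R n A B) C =
      block_mat n n (mat_mult R n A a) (mat_mult R n A b) (mat_mult R n B c) (mat_mult R n B d)"
    unfolding C_eq mat_dsum_eq_block_mat
      block_mat_mult[OF A zero_mats zero_mats B abcd]
    by (simp add: z m A B abcd)
  moreover have "mat_mult R (n + n) C (mat_dsum R n A B) =
      block_mat n n (mat_mult R n a A) (mat_mult R n b B) (mat_mult R n c A) (mat_mult R n d B)"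
    unfolding C_eq mat_dsum_eq_block_mat
      block_mat_mult[OF abcd A zero_mats zero_mats B]
    by (simp add: z m A B abcd)
  ultimately have eq: "block_mat n n (mat_mult R n A a) (mat_mult R n A b) (mat_mult R n B c)
      (mat_mult R n B d)
    = block_mat n n (mat_mult R n a A) (mat_mult R n b B) (mat_mult R n c A) (mat_mult R n d B)"
    using C by (simp add: dsum_commutant_carrier)
  show ?thesis
    by (rule that[OF abcd C_eq])
       (rule block_mat_inject[OF _ _ _ _ _ _ _ _ eq]; (rule mat_mult_closed[where k = n]; fact))+
qed

lemma scalar_mats_in_dsum_commutant:
  assumes "A \<in> mats R n n" "B \<in> mats R n n" "r \<in> carrier R"
  shows "scalar_mat R (n + n) r \<in> carrier (dsum_commutant n A B)"
  using assms mats_carrier[OF mat_dsum_closed[OF assms(1,2)]]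
  by (simp add: dsum_commutant_carrier mat_mult_scalar_left[OF _ mat_dsum_closed]
        mat_mult_scalar_right[OF _ mat_dsum_closed] m_comm)

text \<open>Scalar matrices lie in the commutant. For the class of an indicator this cuts an element
  down to a set; for general r it makes corner entries absorb R.\<close>

lemma dsum_commutant_smult:
  assumes "A \<in> mats R n n" "B \<in> mats R n n" "r \<in> carrier R" "c \<in> carrier (dsum_commutant n A B)"
  shows "(\<lambda>i j. r \<otimes> c i j) \<in> carrier (dsum_commutant n A B)"
proof -
  interpret C: ring "dsum_commutant n A B" by (rule dsum_commutant_ring[OF assms(1,2)])
  have "scalar_mat R (n + n) r \<otimes>\<^bsub>dsum_commutant n A B\<^esub> c \<in> carrier (dsum_commutant n A B)"
    by (intro C.m_closed scalar_mats_in_dsum_commutant assms)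
  moreover have "scalar_mat R (n + n) r \<otimes>\<^bsub>dsum_commutant n A B\<^esub> c = (\<lambda>i j. r \<otimes> c i j)"
    using assms(4)[unfolded dsum_commutant_carrier] mat_mult_scalar_left[OF assms(3), of c "n + n"
        "n + n"]
    by (simp add: commutant_simps(2) mat_ring_simps(2) mult_2)
  ultimately show ?thesis by simp
qed

lemma dsum_projections:
  assumes "A \<in> mats R n n" "B \<in> mats R n n"
  shows "proj1 n \<in> carrier (dsum_commutant n A B)"
    and "proj2 n \<in> carrier (dsum_commutant n A B)"
    and "proj1 n \<otimes>\<^bsub>dsum_commutant n A B\<^esub> proj1 n = proj1 n" "proj2 n \<otimes>\<^bsub>dsum_commutant n A B\<^esub> proj2 n =
        proj2 n"
proof -
  have 1: "scalar_mat R n \<one> \<in> mats R n n" by simp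
  note z = mat_mult_zero_left[OF zero_mats] mat_mult_zero_left[OF assms(1)] mat_mult_zero_left[OF
      assms(2)]
    mat_mult_zero_right[OF assms(1)] mat_mult_zero_right[OF assms(2)] mats_carrier[OF assms(1)]
        mats_carrier[OF assms(2)]
    mat_mult_scalar_left[OF _ assms(1)] mat_mult_scalar_left[OF _ assms(2)]
        mat_mult_scalar_right[OF _ assms(1)]
    mat_mult_scalar_right[OF _ assms(2)] mat_mult_scalar_left[OF _ 1] mats_carrier[OF 1]
  note E = mat_dsum_eq_block_mat
  note M = mat_dsum_mult[OF assms(1) 1 assms(2) zero_mats] mat_dsum_mult[OF 1 assms(1) zero_mats
      assms(2)]
    mat_dsum_mult[OF assms(1) zero_mats assms(2) 1] mat_dsum_mult[OF zero_mats assms(1) 1 assms(2)]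
    mat_dsum_mult[OF 1 1 zero_mats zero_mats] mat_dsum_mult[OF zero_mats zero_mats 1 1]
  have "mat_mult R (n + n) (mat_dsum R n A B) (proj1 n) = mat_mult R (n + n) (proj1 n) (mat_dsum R
      n A B)"
    "mat_mult R (n + n) (mat_dsum R n A B) (proj2 n) = mat_mult R (n + n) (proj2 n) (mat_dsum R n
        A B)"
    unfolding E M by (simp_all add: z)
  then show "proj1 n \<in> carrier (dsum_commutant n A B)" "proj2 n \<in> carrier (dsum_commutant n A B)"
    using mat_dsum_closed[OF 1 zero_mats] mat_dsum_closed[OF zero_mats 1]
    by (simp_all add: dsum_commutant_carrier)
  show "proj1 n \<otimes>\<^bsub>dsum_commutant n A B\<^esub> proj1 n = proj1 n" "proj2 n \<otimes>\<^bsub>dsum_commutant n A B\<^esub> proj2 n =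
      proj2 n"
    unfolding commutant_simps mat_ring_simps mult_2 E M by (simp_all add: z)
qed

section \<open>Diagonal entries of the commutant modulo a corner ideal\<close>

context
  fixes n A B
  assumes reduced: "\<And>r. r \<in> carrier R \<Longrightarrow> r \<otimes> r = \<zero> \<Longrightarrow> r = \<zero>"
    and A: "regular_triangular n A" and B: "regular_triangular n B"
begin

private lemmas AB_mats = regular_triangularD(1)[OF A] regular_triangularD(1)[OF B]

private lemma commutant_mats: "c \<in> carrier (dsum_commutant n A B) \<Longrightarrow> c \<in> mats R (n + n) (n + n)"
  by (simp add: dsum_commutant_carrier)

private lemma commutant_upper:
  assumes "c \<in> carrier (dsum_commutant n A B)" "j < i" "i < n"
  shows "c i j = \<zero>" "c i (n + j) = \<zero>" "c (n + i) j = \<zero>"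
proof -
  obtain a b c' d where m: "a \<in> mats R n n" "b \<in> mats R n n" "c' \<in> mats R n n" "d \<in> mats R n n"
    and c: "c = block_mat n n a b c' d"
    and i: "mat_mult R n A a = mat_mult R n a A" "mat_mult R n A b = mat_mult R n b B"
      "mat_mult R n B c' = mat_mult R n c' A" "mat_mult R n B d = mat_mult R n d B"
    using AB_mats assms(1) by (rule dsum_commutant_blocksE)
  show "c i j = \<zero>" "c i (n + j) = \<zero>" "c (n + i) j = \<zero>"
    using assms(2,3) intertwiner_upper[OF reduced A A m(1) i(1) assms(2)]
      intertwiner_upper[OF reduced A B m(2) i(2) assms(2)]
      intertwiner_upper[OF reduced B A m(3) i(3) assms(2)]
    by (simp_all add: c block_mat_def)
qed

text \<open>The blocks involved are upper triangular, so an inner index at a position other than k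
  of either summand makes one factor vanish. The surviving cross term passes from the first summand
  to the second and back.\<close>

private lemma commutant_mult_diag:
  assumes "c \<in> carrier (dsum_commutant n A B)" "c' \<in> carrier (dsum_commutant n A B)" "k < n"
  shows "(c \<otimes>\<^bsub>dsum_commutant n A B\<^esub> c') k k = c k k \<otimes> c' k k \<oplus> c k (n + k) \<otimes> c' (n + k) k"
proof -
  note [simp] = mats_carrier[OF commutant_mats[OF assms(1)]] mats_carrier[OF commutant_mats[OF
      assms(2)]]
  have "(\<Oplus>l\<in>{..<n + n}. c k l \<otimes> c' l k) = c k k \<otimes> c' k k \<oplus> c k (n + k) \<otimes> c' (n + k) k"
  proof (rule finsum_eq_pair)
    fix l assume l: "l \<in> {..<n + n}" "l \<noteq> k" "l \<noteq> n + k"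
    show "c k l \<otimes> c' l k = \<zero>"
    proof (cases "l < n")
      case True
      then show ?thesis
        using l assms commutant_upper(1)[OF assms(1), of l k] commutant_upper(1)[OF assms(2), of k
            l]
        by (cases "l < k") auto
    next
      case False
      then obtain l' where l': "l = n + l'" by (metis le_add_diff_inverse not_less)
      then show ?thesis
        using l assms commutant_upper(2)[OF assms(1), of l' k] commutant_upper(3)[OF assms(2), of
            k l']
        by (cases "l' < k") auto
    qed
  qed (use assms in auto)
  then show ?thesis
    by (simp add: commutant_simps mat_ring_simps mat_mult_def mult_2)
qed

private lemma corner_ideal:
  "ideal ((\<lambda>c. c (n + k) k) ` carrier (dsum_commutant n A B)) R"
proof (rule idealI)
  interpret C: ring "dsum_commutant n A B" by (rule dsum_commutant_ring[OF AB_mats])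
  let ?J = "(\<lambda>c. c (n + k) k) ` carrier (dsum_commutant n A B)"
  show "ring R" by (rule ring_axioms)
  have smult: "r \<otimes> c (n + k) k \<in> ?J" if "c \<in> carrier (dsum_commutant n A B)" "r \<in> carrier R" for r c
    using dsum_commutant_smult[OF AB_mats that(2,1)] by force
  have car: "c (n + k) k \<in> carrier R" if "c \<in> carrier (dsum_commutant n A B)" for c
    by (rule mats_carrier[OF commutant_mats[OF that]])
  show "subgroup ?J (add_monoid R)"
  proof (rule group.subgroupI[OF a_group])
    show "?J \<subseteq> carrier (add_monoid R)" using car by auto
    show "?J \<noteq> {}" using C.zero_closed by blast
    fix x assume "x \<in> ?J"
    then obtain c where c: "c \<in> carrier (dsum_commutant n A B)" and x: "x = c (n + k) k" by auto
    have "(\<ominus> \<one>) \<otimes> x \<in> ?J" using smult[OF c, of "\<ominus> \<one>"] x by simp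
    then have "\<ominus> x \<in> ?J" using car[OF c] x by (simp add: l_minus)
    then show "inv\<^bsub>add_monoid R\<^esub> x \<in> ?J" by (simp add: a_inv_def)
    fix y assume "y \<in> ?J"
    then obtain d where d: "d \<in> carrier (dsum_commutant n A B)" and y: "y = d (n + k) k" by auto
    have "(c \<oplus>\<^bsub>dsum_commutant n A B\<^esub> d) (n + k) k \<in> ?J" using c d by (intro imageI) auto
    then show "x \<otimes>\<^bsub>add_monoid R\<^esub> y \<in> ?J"
      by (simp add: x y commutant_simps mat_ring_simps)
  qed
  fix a x assume "a \<in> ?J" and x: "x \<in> carrier R"
  then obtain c where c: "c \<in> carrier (dsum_commutant n A B)" and a: "a = c (n + k) k" by auto
  show "x \<otimes> a \<in> ?J" unfolding a by (rule smult[OF c x])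
  then show "a \<otimes> x \<in> ?J" using x car[OF c] a by (simp add: m_comm)
qed

lemma intertwiner_with_unit_entry:
  assumes "k < n"
    and eq: "K0_class (dsum_commutant n A B) 1
        (scalar_mat (dsum_commutant n A B) 1 (proj1 n)) =
      K0_class (dsum_commutant n A B) 1
        (scalar_mat (dsum_commutant n A B) 1 (proj2 n))"
  obtains u where "u \<in> mats R n n" "mat_mult R n B u = mat_mult R n u A" "u k k = \<one>"
proof -
  let ?C = "dsum_commutant n A B"
  define J where "J = (\<lambda>c. c (n + k) k) ` carrier ?C"
  interpret C: ring ?C by (rule dsum_commutant_ring[OF AB_mats])
  interpret J: ideal J R unfolding J_def by (rule corner_ideal)
  interpret Q: cring "R Quot J" by (rule J.quotient_is_cring[OF cring_axioms])
  \<comment> \<open>A single diagonal entry in place of the full trace: it separates the two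
    projections, at the price of being multiplicative only modulo J.\<close>
  define t where "t c = J +> c k k" for c :: "nat \<Rightarrow> nat \<Rightarrow> 'a"
  have car: "c i j \<in> carrier R" if "c \<in> carrier ?C" for c i j
    by (rule mats_carrier[OF commutant_mats[OF that]])
  have hom1: "J +> x \<in> carrier (R Quot J)" if "x \<in> carrier R" for x
    by (rule ring_hom_closed[OF J.rcos_ring_hom that])
  have hom: "J +> (x \<oplus> y) = (J +> x) \<oplus>\<^bsub>R Quot J\<^esub> (J +> y)"
    "J +> (x \<otimes> y) = (J +> x) \<otimes>\<^bsub>R Quot J\<^esub> (J +> y)"
    if "x \<in> carrier R" "y \<in> carrier R" for x y
    using ring_hom_add[OF J.rcos_ring_hom that]
      ring_hom_mult[OF J.rcos_ring_hom that] by auto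
  have J_zero: "J +> x = \<zero>\<^bsub>R Quot J\<^esub>" if "x \<in> J" for x
    using J.a_rcos_const[OF that] by (simp add: FactRing_def)
  have t: "abelian_group_hom ?C (R Quot J) t"
  proof (rule abelian_group_hom_ringI[OF C.ring_axioms Q.ring_axioms])
    fix c d assume c: "c \<in> carrier ?C"
    show "t c \<in> carrier (R Quot J)" unfolding t_def by (rule hom1[OF car[OF c]])
    assume d: "d \<in> carrier ?C"
    show "t (c \<oplus>\<^bsub>?C\<^esub> d) = t c \<oplus>\<^bsub>R Quot J\<^esub> t d"
      using hom(1)[OF car[OF c] car[OF d]] by (simp add: t_def commutant_simps(3) mat_ring_simps(5))
  qed
  have t_mult: "t (c \<otimes>\<^bsub>?C\<^esub> d) = t c \<otimes>\<^bsub>R Quot J\<^esub> t d"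
    if c: "c \<in> carrier ?C" and d: "d \<in> carrier ?C" for c d
  proof -
    note [simp] = car[OF c] car[OF d]
    have "d (n + k) k \<in> J" using d by (simp add: J_def)
    then have "c k (n + k) \<otimes> d (n + k) k \<in> J" by (rule J.I_l_closed) simp
    then show ?thesis
      using hom1[of "c k k \<otimes> d k k"]
      by (simp add: t_def commutant_mult_diag[OF c d \<open>k < n\<close>] hom J_zero)
  qed
  have t_comm: "t (c \<otimes>\<^bsub>?C\<^esub> d) = t (d \<otimes>\<^bsub>?C\<^esub> c)" if "c \<in> carrier ?C" "d \<in> carrier ?C" for c d
    unfolding t_mult[OF that] t_mult[OF that(2,1)]
    unfolding t_def by (rule Q.m_comm[OF hom1[OF car[OF that(1)]] hom1[OF car[OF that(2)]]])
  obtain \<tau> where \<tau>: "\<And>m e. (m, e) \<in> idempotents ?C \<Longrightarrow>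
      \<tau> (K0_class ?C m e) = (\<Oplus>\<^bsub>R Quot J\<^esub>i\<in>{..<m}. t (e i i))"
    by (rule C.K0_trace[OF t]) (rule t_comm, assumption, assumption, blast)
  note P = dsum_projections[OF AB_mats]
  have "t (proj1 n) = t (proj2 n)"
    using \<tau>[OF C.scalar_idempotent[OF P(1) P(3)]] \<tau>[OF C.scalar_idempotent[OF P(2) P(4)]] eq
    unfolding C.K0_trace_scalar[OF t P(1)] C.K0_trace_scalar[OF t P(2)] by simp
  then have "J +> \<one> = J +> \<zero>"
    using \<open>k < n\<close> by (simp add: t_def mat_dsum_def scalar_mat_def)
  then have "\<one> \<in> J"
    using J.a_rcos_self[of \<one>] by (simp add: a_coset_add_zero[OF J.a_subset])
  \<comment> \<open>Membership of 1 in J unfolds to an element of the commutant, whose lower left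
    block is the required u.\<close>
  then obtain c where c: "c \<in> carrier ?C" "c (n + k) k = \<one>" by (auto simp: J_def)
  obtain a b u d where u: "u \<in> mats R n n" "mat_mult R n B u = mat_mult R n u A"
    and c': "c = block_mat n n a b u d"
    using AB_mats c(1) by (rule dsum_commutant_blocksE)
  show ?thesis
    using u by (rule that) (use c c' \<open>k < n\<close> in \<open>simp add: block_mat_def\<close>)
qed

theorem similar_if_K0_class_eq:
  assumes eq: "K0_class (dsum_commutant n A B) 1
        (scalar_mat (dsum_commutant n A B) 1 (proj1 n)) =
      K0_class (dsum_commutant n A B) 1
        (scalar_mat (dsum_commutant n A B) 1 (proj2 n))"
    and "n \<ge> 1"
  shows "similar_in (mat_ring R n) A B"
proof -
  interpret M: ring "mat_ring R n" by (rule mat_ring_is_ring)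
  \<comment> \<open>This u, normalised at position 0, will implement the similarity. The
    intertwiners v below, one for each k, only certify that its diagonal entries are
    invertible.\<close>
  obtain u where u: "u \<in> mats R n n" "mat_mult R n B u = mat_mult R n u A" "u 0 0 = \<one>"
    using intertwiner_with_unit_entry[OF _ eq, of 0] \<open>n \<ge> 1\<close> by auto
  have "u k k \<in> Units R" if "k < n" for k
  proof -
    obtain v where v: "v \<in> mats R n n" "mat_mult R n B v = mat_mult R n v A" "v k k = \<one>"
      using \<open>k < n\<close> eq by (rule intertwiner_with_unit_entry)
    have "u k k \<otimes> v 0 0 = \<one>"
      using intertwiners_diag_ratio[OF reduced B A u(1,2) v(1,2) that] u(3) v(3) by simp
    then show ?thesis
      using mats_carrier[OF u(1)] mats_carrier[OF v(1)]
      by (auto simp: Units_def m_comm intro!: bexI[of _ "v 0 0"])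
  qed
  then have U: "u \<in> Units (mat_ring R n)"
    by (intro upper_triangular_Units[OF u(1)] intertwiner_upper[OF reduced B A u(1,2)])
  have c: "u \<in> carrier (mat_ring R n)" "A \<in> carrier (mat_ring R n)" "B \<in> carrier (mat_ring R n)"
    using u(1) AB_mats by (simp_all add: mat_ring_simps)
  have "u \<otimes>\<^bsub>mat_ring R n\<^esub> A = B \<otimes>\<^bsub>mat_ring R n\<^esub> u"
    using u(2) by (simp add: mat_ring_simps)
  then have "u \<otimes>\<^bsub>mat_ring R n\<^esub> A \<otimes>\<^bsub>mat_ring R n\<^esub> inv\<^bsub>mat_ring R n\<^esub> u = B"
    using U c by (simp add: M.m_assoc M.Units_r_inv)
  then show ?thesis using U by (auto simp: similar_in_def)
qed

end

end

section \<open>Essentially bounded functions and integer-valued functions\<close>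

lemma ess_bounded_ring_carrier:
  "f \<in> carrier (ess_bounded_ring M) \<longleftrightarrow> f \<in> borel_measurable M \<and> (\<exists>c. AE x in M. norm (f x) \<le> c)"
  by (simp add: ess_bounded_ring_def)

lemma ess_bounded_ring_simps:
  "x \<otimes>\<^bsub>ess_bounded_ring M\<^esub> y = (\<lambda>t. x t * y t)" "x \<oplus>\<^bsub>ess_bounded_ring M\<^esub> y = (\<lambda>t. x t + y t)"
  "\<one>\<^bsub>ess_bounded_ring M\<^esub> = (\<lambda>_. 1)" "\<zero>\<^bsub>ess_bounded_ring M\<^esub> = (\<lambda>_. 0)"
  by (simp_all add: ess_bounded_ring_def)

lemma ess_bounded_mult:
  assumes "f \<in> carrier (ess_bounded_ring M)" "g \<in> carrier (ess_bounded_ring M)"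
  shows "(\<lambda>x. f x * g x) \<in> carrier (ess_bounded_ring M)"
proof -
  obtain c d where c: "AE x in M. norm (f x) \<le> c" and d: "AE x in M. norm (g x) \<le> d"
    using assms by (auto simp: ess_bounded_ring_carrier)
  from c d have "AE x in M. norm (f x * g x) \<le> c * d"
  proof eventually_elim
    case (elim x)
    then show ?case
      unfolding norm_mult by (intro mult_mono) (auto intro: order_trans[OF norm_ge_zero])
  qed
  then show ?thesis using assms by (auto simp: ess_bounded_ring_carrier)
qed

lemma ess_bounded_add:
  assumes "f \<in> carrier (ess_bounded_ring M)" "g \<in> carrier (ess_bounded_ring M)"
  shows "(\<lambda>x. f x + g x) \<in> carrier (ess_bounded_ring M)"
proof -
  obtain c d where c: "AE x in M. norm (f x) \<le> c" and d: "AE x in M. norm (g x) \<le> d"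
    using assms by (auto simp: ess_bounded_ring_carrier)
  from c d have "AE x in M. norm (f x + g x) \<le> c + d"
    by eventually_elim (rule norm_triangle_mono)
  then show ?thesis using assms by (auto simp: ess_bounded_ring_carrier)
qed

lemma ess_bounded_const: "(\<lambda>_. c) \<in> carrier (ess_bounded_ring M)"
  by (auto simp: ess_bounded_ring_carrier)

lemma ess_bounded_ring_cring: "cring (ess_bounded_ring M)"
proof (rule cringI)
  show "abelian_group (ess_bounded_ring M)"
  proof (rule abelian_groupI)
    fix f assume f: "f \<in> carrier (ess_bounded_ring M)"
    show "\<exists>g\<in>carrier (ess_bounded_ring M). g \<oplus>\<^bsub>ess_bounded_ring M\<^esub> f = \<zero>\<^bsub>ess_bounded_ring M\<^esub>"
      using ess_bounded_mult[OF ess_bounded_const[of "-1"] f]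
      by (rule bexI[rotated]) (simp add: ess_bounded_ring_simps)
  qed (auto simp: ess_bounded_ring_simps ess_bounded_add ess_bounded_const add_ac)
  show "comm_monoid (ess_bounded_ring M)"
    by (rule comm_monoidI)
       (auto simp: ess_bounded_ring_simps ess_bounded_mult ess_bounded_const mult_ac)
qed (auto simp: ess_bounded_ring_simps algebra_simps)

lemma null_functions_ideal: "ideal (null_functions M) (ess_bounded_ring M)"
proof (rule idealI)
  interpret E: cring "ess_bounded_ring M" by (rule ess_bounded_ring_cring)
  show "ring (ess_bounded_ring M)" by (rule E.ring_axioms)
  have sub: "f \<in> carrier (ess_bounded_ring M)" if "f \<in> null_functions M" for f
  proof -
    have "AE x in M. norm (f x) \<le> 0" using that by (auto simp: null_functions_def)
    then show ?thesis using that by (auto simp: null_functions_def ess_bounded_ring_carrier)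
  qed
  show "subgroup (null_functions M) (add_monoid (ess_bounded_ring M))"
  proof (rule group.subgroupI[OF E.a_group])
    show "null_functions M \<subseteq> carrier (add_monoid (ess_bounded_ring M))" using sub by auto
    show "null_functions M \<noteq> {}" by (auto simp: null_functions_def intro!: exI[of _ "\<lambda>_. 0"])
    fix f assume f: "f \<in> null_functions M"
    have "\<ominus>\<^bsub>ess_bounded_ring M\<^esub> f = (\<lambda>x. - f x)"
      using ess_bounded_mult[OF ess_bounded_const[of "-1"] sub[OF f]] sub[OF f]
      by (intro E.minus_equality) (auto simp: ess_bounded_ring_simps)
    then show "inv\<^bsub>add_monoid (ess_bounded_ring M)\<^esub> f \<in> null_functions M"
      using f by (simp add: a_inv_def null_functions_def)
    fix g assume "g \<in> null_functions M"
    then show "f \<otimes>\<^bsub>add_monoid (ess_bounded_ring M)\<^esub> g \<in> null_functions M"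
      using f by (auto simp: null_functions_def ess_bounded_ring_simps)
  qed
qed (auto simp: null_functions_def ess_bounded_ring_simps ess_bounded_ring_carrier)

lemma Linf_cring: "cring (Linf M)"
  unfolding Linf_def by (rule ideal.quotient_is_cring[OF null_functions_ideal
      ess_bounded_ring_cring])

lemma Linf_class_hom: "Linf_class M \<in> ring_hom (ess_bounded_ring M) (Linf M)"
proof -
  have "Linf_class M = (+>\<^bsub>ess_bounded_ring M\<^esub>) (null_functions M)"
    by (auto simp: Linf_class_def)
  then show ?thesis
    unfolding Linf_def using ideal.rcos_ring_hom[OF null_functions_ideal] by simp
qed

lemma Linf_class_closed: "f \<in> carrier (ess_bounded_ring M) \<Longrightarrow> Linf_class M f \<in> carrier (Linf M)"
  by (rule ring_hom_closed[OF Linf_class_hom])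

lemma Linf_carrierE:
  assumes "a \<in> carrier (Linf M)"
  obtains f where "f \<in> carrier (ess_bounded_ring M)" "a = Linf_class M f"
  using assms by (auto simp: Linf_def FactRing_simps Linf_class_def a_r_coset_def)

lemma Linf_class_mult:
  assumes "f \<in> carrier (ess_bounded_ring M)" "g \<in> carrier (ess_bounded_ring M)"
  shows "Linf_class M f \<otimes>\<^bsub>Linf M\<^esub> Linf_class M g = Linf_class M (\<lambda>x. f x * g x)"
  using ring_hom_mult[OF Linf_class_hom assms] by (simp add: ess_bounded_ring_simps)

lemma Linf_class_add:
  assumes "f \<in> carrier (ess_bounded_ring M)" "g \<in> carrier (ess_bounded_ring M)"
  shows "Linf_class M f \<oplus>\<^bsub>Linf M\<^esub> Linf_class M g = Linf_class M (\<lambda>x. f x + g x)"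
  using ring_hom_add[OF Linf_class_hom assms] by (simp add: ess_bounded_ring_simps)

lemma Linf_class_self:
  assumes "f \<in> carrier (ess_bounded_ring M)"
  shows "f \<in> Linf_class M f"
proof -
  interpret N: ideal "null_functions M" "ess_bounded_ring M" by (rule null_functions_ideal)
  show ?thesis unfolding Linf_class_def by (rule N.a_rcos_self[OF assms])
qed

lemma Linf_class_eq_zero_iff:
  assumes f: "f \<in> carrier (ess_bounded_ring M)"
  shows "Linf_class M f = \<zero>\<^bsub>Linf M\<^esub> \<longleftrightarrow> (AE x in M. f x = 0)"
proof -
  interpret N: ideal "null_functions M" "ess_bounded_ring M" by (rule null_functions_ideal)
  have zero: "\<zero>\<^bsub>Linf M\<^esub> = null_functions M" by (simp add: Linf_def FactRing_def)
  have "Linf_class M f = \<zero>\<^bsub>Linf M\<^esub> \<longleftrightarrow> f \<in> null_functions M"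
    unfolding zero using Linf_class_self[OF f] N.a_rcos_const by (auto simp: Linf_class_def)
  then show ?thesis using f by (auto simp: null_functions_def ess_bounded_ring_carrier)
qed

text \<open>Values lie in a field, so f(x) f(x) = 0 forces f(x) = 0 at each such point.\<close>

lemma Linf_reduced:
  assumes "a \<in> carrier (Linf M)" "a \<otimes>\<^bsub>Linf M\<^esub> a = \<zero>\<^bsub>Linf M\<^esub>"
  shows "a = \<zero>\<^bsub>Linf M\<^esub>"
proof -
  obtain f where f: "f \<in> carrier (ess_bounded_ring M)" "a = Linf_class M f"
    using assms(1) by (rule Linf_carrierE)
  show ?thesis
    using assms(2) unfolding f(2) Linf_class_mult[OF f(1) f(1)]
      Linf_class_eq_zero_iff[OF ess_bounded_mult[OF f(1) f(1)]] Linf_class_eq_zero_iff[OF f(1)]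
    by simp
qed

text \<open>Turns the support hypothesis into the last clause of \<open>regular_triangular\<close>.
  \<open>full_support\<close> controls points of \<Lambda> only; the third assumption makes these
  almost all points.\<close>

lemma full_support_regular:
  assumes "a \<in> carrier (Linf M)" "full_support M \<Lambda> a" "AE x in M. x \<in> \<Lambda>"
    and "b \<in> carrier (Linf M)" "a \<otimes>\<^bsub>Linf M\<^esub> b = \<zero>\<^bsub>Linf M\<^esub>"
  shows "b = \<zero>\<^bsub>Linf M\<^esub>"
proof -
  obtain f where f: "f \<in> carrier (ess_bounded_ring M)" "a = Linf_class M f"
    using assms(1) by (rule Linf_carrierE)
  obtain g where g: "g \<in> carrier (ess_bounded_ring M)" "b = Linf_class M g"
    using assms(4) by (rule Linf_carrierE)
  have "AE x in M. x \<in> \<Lambda> \<longrightarrow> f x \<noteq> 0"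
    using assms(2) Linf_class_self[OF f(1)] by (simp add: full_support_def f(2))
  moreover have "AE x in M. f x * g x = 0"
    using assms(5) unfolding f(2) g(2) Linf_class_mult[OF f(1) g(1)]
      Linf_class_eq_zero_iff[OF ess_bounded_mult[OF f(1) g(1)]] .
  ultimately have "AE x in M. g x = 0"
    using assms(3) by eventually_elim auto
  then show ?thesis by (simp add: g(2) Linf_class_eq_zero_iff[OF g(1)])
qed

text \<open>A homomorphism from the integers is determined by its value at 1. This evaluates integer
  powers in quotient groups from an explicit formula on representatives.\<close>

lemma (in group) int_pow_unique:
  fixes g :: "int \<Rightarrow> 'a"
  assumes closed: "\<And>i. g i \<in> carrier G" and add: "\<And>i j. g (i + j) = g i \<otimes> g j"
  shows "g 1 [^] k = g k"
proof (induction k rule: int_induct[where k = 0])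
  case base
  have "g 0 \<otimes> g 0 = g 0" using add[of 0 0] by simp
  then have "g 0 = \<one>" using closed by (metis l_cancel_one)
  then show ?case by simp
next
  case (step1 i)
  then show ?case using closed by (simp add: int_pow_mult add)
next
  case (step2 i)
  have "g (i - 1) \<otimes> g 1 = g i" using add[of "i - 1" 1] by simp
  then have "g (i - 1) = g i \<otimes> inv g 1" using closed by (metis inv_solve_right)
  then show ?case using step2 closed by (simp add: int_pow_diff)
qed

section \<open>The group of bounded Borel functions with integer values\<close>

lemma bounded_borel_int_fun_carrier:
  "\<phi> \<in> carrier (bounded_borel_int_fun \<Lambda>) \<longleftrightarrow> \<phi> \<in> extensional \<Lambda> \<and>
    \<phi> \<in> restrict_space borel \<Lambda> \<rightarrow>\<^sub>M count_space UNIV \<and> (\<exists>c. \<forall>x\<in>\<Lambda>. \<bar>\<phi> x\<bar> \<le> c)"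
  by (simp add: bounded_borel_int_fun_def PiE_def)

lemma bounded_borel_int_fun_comm_group: "comm_group (bounded_borel_int_fun \<Lambda>)"
proof (rule comm_groupI)
  let ?F = "bounded_borel_int_fun \<Lambda>"
  \<comment> \<open>One statement serves for sums and, with h ignoring its second argument, for
    negatives.\<close>
  have meas: "(\<lambda>x\<in>\<Lambda>. h (\<phi> x) (\<psi> x)) \<in> restrict_space borel \<Lambda> \<rightarrow>\<^sub>M count_space UNIV"
    if "\<phi> \<in> carrier ?F" "\<psi> \<in> carrier ?F" for \<phi> \<psi> :: "complex \<Rightarrow> int" and h :: "int \<Rightarrow> int \<Rightarrow> int"
  proof -
    have [measurable]: "\<phi> \<in> restrict_space borel \<Lambda> \<rightarrow>\<^sub>M count_space UNIV"
      "\<psi> \<in> restrict_space borel \<Lambda> \<rightarrow>\<^sub>M count_space UNIV"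
      using that by (auto simp: bounded_borel_int_fun_carrier)
    have "(\<lambda>x. h (\<phi> x) (\<psi> x)) \<in> restrict_space borel \<Lambda> \<rightarrow>\<^sub>M count_space UNIV"
      by measurable
    then show ?thesis
      by (rule measurable_cong[THEN iffD1, rotated]) (simp add: space_restrict_space)
  qed
  have const: "(\<lambda>x\<in>\<Lambda>. 0) \<in> carrier ?F"
  proof -
    have "(\<lambda>x\<in>\<Lambda>. 0 :: int) \<in> restrict_space borel \<Lambda> \<rightarrow>\<^sub>M count_space UNIV"
      by (rule measurable_cong[THEN iffD1, OF _ measurable_const[of 0]]) (simp_all add:
          space_restrict_space)
    then show ?thesis by (auto simp: bounded_borel_int_fun_carrier intro!: exI[of _ 0])
  qed
  show "\<one>\<^bsub>?F\<^esub> \<in> carrier ?F" using const by (simp add: bounded_borel_int_fun_def)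
  fix \<phi> assume \<phi>: "\<phi> \<in> carrier ?F"
  show "\<one>\<^bsub>?F\<^esub> \<otimes>\<^bsub>?F\<^esub> \<phi> = \<phi>"
    using \<phi> by (auto simp: bounded_borel_int_fun_def PiE_def extensional_def intro!: ext)
  have "(\<lambda>x\<in>\<Lambda>. - \<phi> x) \<in> carrier ?F"
    using meas[OF \<phi> \<phi>, of "\<lambda>a _. - a"] \<phi> by (auto simp: bounded_borel_int_fun_carrier)
  then show "\<exists>\<psi>\<in>carrier ?F. \<psi> \<otimes>\<^bsub>?F\<^esub> \<phi> = \<one>\<^bsub>?F\<^esub>"
    by (rule bexI[rotated]) (auto simp: bounded_borel_int_fun_def)
  fix \<psi> assume \<psi>: "\<psi> \<in> carrier ?F"
  obtain c d where c: "\<And>x. x \<in> \<Lambda> \<Longrightarrow> \<bar>\<phi> x\<bar> \<le> c" and d: "\<And>x. x \<in> \<Lambda> \<Longrightarrow> \<bar>\<psi> x\<bar> \<le> d"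
    using \<phi> \<psi> by (auto simp: bounded_borel_int_fun_carrier)
  have "\<forall>x\<in>\<Lambda>. \<bar>(\<lambda>x\<in>\<Lambda>. \<phi> x + \<psi> x) x\<bar> \<le> c + d"
    using c d by (auto intro: order_trans[OF abs_triangle_ineq] add_mono)
  then have "(\<lambda>x\<in>\<Lambda>. \<phi> x + \<psi> x) \<in> carrier ?F"
    unfolding bounded_borel_int_fun_carrier using meas[OF \<phi> \<psi>, of "(+)"] by blast
  then show "\<phi> \<otimes>\<^bsub>?F\<^esub> \<psi> \<in> carrier ?F" by (simp add: bounded_borel_int_fun_def)
  show "\<phi> \<otimes>\<^bsub>?F\<^esub> \<psi> = \<psi> \<otimes>\<^bsub>?F\<^esub> \<phi>" by (auto simp: bounded_borel_int_fun_def add.commute)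
  fix \<rho>
  show "\<phi> \<otimes>\<^bsub>?F\<^esub> \<psi> \<otimes>\<^bsub>?F\<^esub> \<rho> = \<phi> \<otimes>\<^bsub>?F\<^esub> (\<psi> \<otimes>\<^bsub>?F\<^esub> \<rho>)"
    by (auto simp: bounded_borel_int_fun_def intro!: ext)
qed

definition null_int_funs where
  "null_int_funs M \<Lambda> = {\<phi> \<in> carrier (bounded_borel_int_fun \<Lambda>). AE x in M. x \<in> \<Lambda> \<longrightarrow> \<phi> x = 0}"

lemma bounded_borel_int_fun_minus:
  assumes "\<phi> \<in> carrier (bounded_borel_int_fun \<Lambda>)"
  shows "inv\<^bsub>bounded_borel_int_fun \<Lambda>\<^esub> \<phi> = (\<lambda>x\<in>\<Lambda>. - \<phi> x)"
proof -
  interpret F: comm_group "bounded_borel_int_fun \<Lambda>" by (rule bounded_borel_int_fun_comm_group)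
  let ?\<psi> = "inv\<^bsub>bounded_borel_int_fun \<Lambda>\<^esub> \<phi>"
  have c: "?\<psi> \<in> extensional \<Lambda>" using F.inv_closed[OF assms] by (simp add:
      bounded_borel_int_fun_carrier)
  have "?\<psi> \<otimes>\<^bsub>bounded_borel_int_fun \<Lambda>\<^esub> \<phi> = \<one>\<^bsub>bounded_borel_int_fun \<Lambda>\<^esub>"
    using assms by simp
  then have "?\<psi> x + \<phi> x = 0" if "x \<in> \<Lambda>" for x
    using that by (auto simp: bounded_borel_int_fun_def dest!: fun_cong[of _ _ x])
  then have "?\<psi> x = - \<phi> x" if "x \<in> \<Lambda>" for x
    using that by (simp add: eq_neg_iff_add_eq_0)
  then show ?thesis using c by (auto simp: extensional_def intro!: ext)
qed

lemma null_int_funs_normal: "null_int_funs M \<Lambda> \<lhd> bounded_borel_int_fun \<Lambda>"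
proof -
  interpret F: comm_group "bounded_borel_int_fun \<Lambda>" by (rule bounded_borel_int_fun_comm_group)
  have "subgroup (null_int_funs M \<Lambda>) (bounded_borel_int_fun \<Lambda>)"
  proof (rule F.subgroupI)
    show "null_int_funs M \<Lambda> \<noteq> {}"
    proof -
      have "\<one>\<^bsub>bounded_borel_int_fun \<Lambda>\<^esub> x = 0" if "x \<in> \<Lambda>" for x
        using that by (simp add: bounded_borel_int_fun_def)
      then have "\<one>\<^bsub>bounded_borel_int_fun \<Lambda>\<^esub> \<in> null_int_funs M \<Lambda>"
        by (simp add: null_int_funs_def)
      then show ?thesis by blast
    qed
    fix \<phi> assume \<phi>: "\<phi> \<in> null_int_funs M \<Lambda>"
    then have "\<phi> \<in> carrier (bounded_borel_int_fun \<Lambda>)" by (simp add: null_int_funs_def)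
    then show "inv\<^bsub>bounded_borel_int_fun \<Lambda>\<^esub> \<phi> \<in> null_int_funs M \<Lambda>"
      using \<phi> F.inv_closed[of \<phi>] unfolding null_int_funs_def
      by (auto simp: bounded_borel_int_fun_minus)
    fix \<psi> assume \<psi>: "\<psi> \<in> null_int_funs M \<Lambda>"
    have "AE x in M. x \<in> \<Lambda> \<longrightarrow> \<phi> x = 0" "AE x in M. x \<in> \<Lambda> \<longrightarrow> \<psi> x = 0"
      using \<phi> \<psi> by (simp_all add: null_int_funs_def)
    then have "AE x in M. x \<in> \<Lambda> \<longrightarrow> (\<phi> \<otimes>\<^bsub>bounded_borel_int_fun \<Lambda>\<^esub> \<psi>) x = 0"
      by eventually_elim (auto simp: bounded_borel_int_fun_def)
    then show "\<phi> \<otimes>\<^bsub>bounded_borel_int_fun \<Lambda>\<^esub> \<psi> \<in> null_int_funs M \<Lambda>"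
      using \<phi> \<psi> F.m_closed[of \<phi> \<psi>] by (simp add: null_int_funs_def)
  qed (auto simp: null_int_funs_def)
  then show ?thesis by (rule F.subgroup_imp_normal)
qed

lemma bounded_borel_int_eq: "bounded_borel_int M \<Lambda> = bounded_borel_int_fun \<Lambda> Mod null_int_funs M \<Lambda>"
  by (simp add: bounded_borel_int_def null_int_funs_def)

section \<open>Traces and cut-downs of the two projections\<close>

lemma (in cring) dsum_commutant_trace:
  assumes "A \<in> mats R n n" "B \<in> mats R n n"
  shows "abelian_group_hom (dsum_commutant n A B) R (\<lambda>c. \<Oplus>l\<in>{..<n + n}. c l l)"
    and "c \<in> carrier (dsum_commutant n A B) \<Longrightarrow> d \<in> carrier (dsum_commutant n A B) \<Longrightarrow>
      (\<Oplus>l\<in>{..<n + n}. (c \<otimes>\<^bsub>dsum_commutant n A B\<^esub> d) l l) = (\<Oplus>l\<in>{..<n + n}. (d \<otimes>\<^bsub>dsum_commutant n A B\<^esub>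
          c) l l)"
proof -
  have car: "c i j \<in> carrier R" if "c \<in> carrier (dsum_commutant n A B)" for c i j
    using that mats_carrier[of c "n + n" "n + n"] by (simp add: dsum_commutant_carrier)
  show "abelian_group_hom (dsum_commutant n A B) R (\<lambda>c. \<Oplus>l\<in>{..<n + n}. c l l)"
  proof (rule abelian_group_hom_ringI[OF dsum_commutant_ring[OF assms] ring_axioms])
    fix c d assume c: "c \<in> carrier (dsum_commutant n A B)"
    show "(\<Oplus>l\<in>{..<n + n}. c l l) \<in> carrier R"
      using car[OF c] by (intro finsum_closed) auto
    assume d: "d \<in> carrier (dsum_commutant n A B)"
    show "(\<Oplus>l\<in>{..<n + n}. (c \<oplus>\<^bsub>dsum_commutant n A B\<^esub> d) l l) =
        (\<Oplus>l\<in>{..<n + n}. c l l) \<oplus> (\<Oplus>l\<in>{..<n + n}. d l l)"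
      using car[OF c] car[OF d] by (simp add: commutant_simps(3) mat_ring_simps(5) finsum_addf
          Pi_def)
  qed
  assume c: "c \<in> carrier (dsum_commutant n A B)" and d: "d \<in> carrier (dsum_commutant n A B)"
  show "(\<Oplus>l\<in>{..<n + n}. (c \<otimes>\<^bsub>dsum_commutant n A B\<^esub> d) l l) = (\<Oplus>l\<in>{..<n + n}. (d \<otimes>\<^bsub>dsum_commutant n A
      B\<^esub> c) l l)"
    unfolding commutant_simps(2) mat_ring_simps(2) mat_mult_def mult_2
    using car[OF c] car[OF d] by (subst finsum_swap) (auto simp: m_comm)
qed

lemma Linf_class_finsum_const:
  assumes f: "f \<in> carrier (ess_bounded_ring M)"
  shows "(\<Oplus>\<^bsub>Linf M\<^esub>l\<in>{..<n}. Linf_class M f) = Linf_class M (\<lambda>x. of_nat n * f x)"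
proof (induction n)
  interpret L: cring "Linf M" by (rule Linf_cring)
  case 0
  show ?case using Linf_class_eq_zero_iff[OF ess_bounded_const[of 0 M]] by simp
next
  interpret L: cring "Linf M" by (rule Linf_cring)
  case (Suc n)
  have "(\<Oplus>\<^bsub>Linf M\<^esub>l\<in>{..<Suc n}. Linf_class M f) = Linf_class M (\<lambda>x. of_nat n * f x) \<oplus>\<^bsub>Linf M\<^esub>
      Linf_class M f"
    using Linf_class_closed[OF f] Suc by (subst L.finsum_lessThan_Suc) auto
  also have "\<dots> = Linf_class M (\<lambda>x. of_nat n * f x + f x)"
    by (rule Linf_class_add[OF ess_bounded_mult[OF ess_bounded_const f] f])
  finally show ?case by (simp add: algebra_simps)
qed

text \<open>Each projection has n ones on its diagonal, so both cut-downs have trace n a. This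
  equality is later set against the integer values that the isomorphism assigns to the two
  projections.\<close>

lemma (in cring) dsum_projections_smult_trace:
  assumes "a \<in> carrier R"
  shows "(\<Oplus>l\<in>{..<n + n}. a \<otimes> proj1 n l l) = (\<Oplus>l\<in>{..<n}. a)"
    and "(\<Oplus>l\<in>{..<n + n}. a \<otimes> proj2 n l l) = (\<Oplus>l\<in>{..<n}. a)"
proof -
  have 0: "(\<Oplus>l\<in>{..<n}. \<zero>) = \<zero>" by simp
  have "(\<Oplus>l\<in>{..<n}. a \<otimes> proj1 n l l) = (\<Oplus>l\<in>{..<n}. a)" "(\<Oplus>l\<in>{..<n}. a \<otimes> proj1 n (n + l) (n + l)) =
      \<zero>"
    "(\<Oplus>l\<in>{..<n}. a \<otimes> proj2 n (n + l) (n + l)) = (\<Oplus>l\<in>{..<n}. a)" "(\<Oplus>l\<in>{..<n}. a \<otimes> proj2 n l l) = \<zero>"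
    using assms
    by (auto simp: mat_dsum_def scalar_mat_def intro!: finsum_cong' add.finprod_one_eqI)
  moreover have "a \<otimes> proj1 n l l \<in> carrier R" "a \<otimes> proj2 n l l \<in> carrier R" for l
    using assms by (auto simp: mat_dsum_def scalar_mat_def)
  ultimately show "(\<Oplus>l\<in>{..<n + n}. a \<otimes> proj1 n l l) = (\<Oplus>l\<in>{..<n}. a)"
    "(\<Oplus>l\<in>{..<n + n}. a \<otimes> proj2 n l l) = (\<Oplus>l\<in>{..<n}. a)"
    using assms by (simp_all add: finsum_lessThan_add finsum_closed)
qed

lemma (in cring) dsum_commutant_smult_idempotent:
  assumes A: "A \<in> mats R n n" and B: "B \<in> mats R n n" and a: "a \<in> carrier R" "a \<otimes> a = a"
    and P: "P \<in> carrier (dsum_commutant n A B)" "P \<otimes>\<^bsub>dsum_commutant n A B\<^esub> P = P"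
  shows "(\<lambda>i j. a \<otimes> P i j) \<otimes>\<^bsub>dsum_commutant n A B\<^esub> (\<lambda>i j. a \<otimes> P i j) = (\<lambda>i j. a \<otimes> P i j)"
proof (intro ext)
  fix i j
  note [simp] = mats_carrier[OF conjunct1[OF P(1)[unfolded dsum_commutant_carrier]]] a(1)
  have "((\<lambda>i j. a \<otimes> P i j) \<otimes>\<^bsub>dsum_commutant n A B\<^esub> (\<lambda>i j. a \<otimes> P i j)) i j
    = (\<Oplus>l\<in>{..<n + n}. (a \<otimes> P i l) \<otimes> (a \<otimes> P l j))"
    by (simp add: commutant_simps(2) mat_ring_simps(2) mat_mult_def mult_2)
  also have "\<dots> = (\<Oplus>l\<in>{..<n + n}. a \<otimes> (P i l \<otimes> P l j))"
  proof (rule finsum_cong')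
    fix l
    have "(a \<otimes> P i l) \<otimes> (a \<otimes> P l j) = (a \<otimes> a) \<otimes> (P i l \<otimes> P l j)"
      by (simp add: m_ac)
    then show "(a \<otimes> P i l) \<otimes> (a \<otimes> P l j) = a \<otimes> (P i l \<otimes> P l j)"
      by (simp only: a(2))
  qed auto
  also have "\<dots> = a \<otimes> (\<Oplus>l\<in>{..<n + n}. P i l \<otimes> P l j)"
    by (simp add: finsum_rdistr Pi_def)
  also have "(\<Oplus>l\<in>{..<n + n}. P i l \<otimes> P l j) = P i j"
    using fun_cong[OF fun_cong[OF P(2), of i], of j]
    by (simp add: commutant_simps(2) mat_ring_simps(2) mat_mult_def mult_2)
  finally show "((\<lambda>i j. a \<otimes> P i j) \<otimes>\<^bsub>dsum_commutant n A B\<^esub> (\<lambda>i j. a \<otimes> P i j)) i j = a \<otimes> P i j" .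
qed

lemma indicator_ess_bounded:
  fixes \<nu> :: "complex measure"
  assumes "sets \<nu> = sets borel" "\<sigma> \<in> sets borel"
  shows "indicator \<sigma> \<in> carrier (ess_bounded_ring (completion \<nu>))"
proof -
  have "\<sigma> \<in> sets (completion \<nu>)" using assms by auto
  then have "(indicator \<sigma> :: complex \<Rightarrow> complex) \<in> borel_measurable (completion \<nu>)"
    by (rule borel_measurable_indicator)
  moreover have "AE x in completion \<nu>. norm (indicator \<sigma> x :: complex) \<le> 1"
    by (rule AE_I2) (simp add: indicator_def)
  ultimately show ?thesis by (auto simp: ess_bounded_ring_carrier)
qed

lemma int_indicator_bounded_borel:
  assumes "\<sigma> \<in> sets borel"
  shows "(\<lambda>x\<in>\<Lambda>. k * indicator \<sigma> x) \<in> carrier (bounded_borel_int_fun \<Lambda>)"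
proof -
  have [measurable]: "\<sigma> \<in> sets borel" by fact
  have "(\<lambda>x. if x \<in> \<sigma> then k else 0) \<in> borel \<rightarrow>\<^sub>M count_space UNIV" by measurable
  then have "(\<lambda>x. if x \<in> \<sigma> then k else 0) \<in> restrict_space borel \<Lambda> \<rightarrow>\<^sub>M count_space UNIV"
    by (rule measurable_restrict_space1)
  then have "(\<lambda>x\<in>\<Lambda>. k * indicator \<sigma> x) \<in> restrict_space borel \<Lambda> \<rightarrow>\<^sub>M count_space UNIV"
    by (rule measurable_cong[THEN iffD1, rotated]) (simp add: space_restrict_space)
  moreover have "\<forall>x\<in>\<Lambda>. \<bar>(\<lambda>x\<in>\<Lambda>. k * indicator \<sigma> x) x\<bar> \<le> \<bar>k\<bar>" by (simp add: indicator_def)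
  ultimately show ?thesis by (auto simp: bounded_borel_int_fun_carrier)
qed

text \<open>\<open>cut_down\<close> acts on every entry of the outer matrix. Entries outside the 1
  by 1 corner are zero matrices and stay zero (\<open>mz\<close>); inside, multiplying by a scalar
  matrix acts entrywise.\<close>

lemma cut_down_scalar:
  fixes M N A
  assumes "P \<in> mats (Linf M) N N" "Linf_class M (indicator \<sigma>) \<in> carrier (Linf M)"
  defines "C \<equiv> commutant (mat_ring (Linf M) N) A"
  shows "cut_down M N \<sigma> (scalar_mat C 1 P) =
    scalar_mat C 1 (\<lambda>i j. Linf_class M (indicator \<sigma>) \<otimes>\<^bsub>Linf M\<^esub> P i j)"
proof -
  interpret L: cring "Linf M" by (rule Linf_cring)
  have z: "\<zero>\<^bsub>C\<^esub> = (\<lambda>_ _. \<zero>\<^bsub>Linf M\<^esub>)" by (simp add: C_def commutant_simps mat_ring_simps)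
  have mz: "mat_mult (Linf M) N (scalar_mat (Linf M) N (Linf_class M (indicator \<sigma>))) (\<lambda>_ _. \<zero>\<^bsub>Linf M\<^esub>)
      = (\<lambda>_ _. \<zero>\<^bsub>Linf M\<^esub>)"
    by (rule L.mat_mult_zero_right[OF L.scalar_mats[OF assms(2)]])
  show ?thesis
  proof (rule ext, rule ext)
    fix i j
    show "cut_down M N \<sigma> (scalar_mat C 1 P) i j =
      scalar_mat C 1 (\<lambda>i j. Linf_class M (indicator \<sigma>) \<otimes>\<^bsub>Linf M\<^esub> P i j) i j"
      using L.mat_mult_scalar_left[OF assms(2,1)]
      by (simp add: cut_down_def scalar_mat_def[of C] z mat_ring_simps mz)
  qed
qed

section \<open>Comparing the two projections\<close>

lemma bounded_borel_int_carrierE: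
  assumes "X \<in> carrier (bounded_borel_int M \<Lambda>)"
  obtains \<phi> where "\<phi> \<in> carrier (bounded_borel_int_fun \<Lambda>)"
    "X = null_int_funs M \<Lambda> #>\<^bsub>bounded_borel_int_fun \<Lambda>\<^esub> \<phi>"
  using assms by (auto simp: bounded_borel_int_eq FactGroup_def RCOSETS_def)

text \<open>Compatibility with cut-downs is formulated as membership in a coset; this turns it into
  an equality of cosets.\<close>

lemma bounded_borel_int_mem:
  assumes "X \<in> carrier (bounded_borel_int M \<Lambda>)" "\<psi> \<in> X"
  shows "X = null_int_funs M \<Lambda> #>\<^bsub>bounded_borel_int_fun \<Lambda>\<^esub> \<psi>"
proof -
  interpret N: normal "null_int_funs M \<Lambda>" "bounded_borel_int_fun \<Lambda>" by (rule null_int_funs_normal)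
  obtain \<phi> where \<phi>: "\<phi> \<in> carrier (bounded_borel_int_fun \<Lambda>)"
    and X: "X = null_int_funs M \<Lambda> #>\<^bsub>bounded_borel_int_fun \<Lambda>\<^esub> \<phi>"
    using assms(1) by (rule bounded_borel_int_carrierE)
  show ?thesis
    using assms(2) unfolding X by (rule N.repr_independence[OF _ \<phi> N.subgroup_axioms])
qed

lemma bounded_borel_int_coset_eqI:
  assumes "\<phi> \<in> carrier (bounded_borel_int_fun \<Lambda>)" "\<psi> \<in> carrier (bounded_borel_int_fun \<Lambda>)"
    and "AE x in M. x \<in> \<Lambda> \<longrightarrow> \<phi> x = \<psi> x"
  shows "null_int_funs M \<Lambda> #>\<^bsub>bounded_borel_int_fun \<Lambda>\<^esub> \<phi> = null_int_funs M \<Lambda> #>\<^bsub>bounded_borel_int_fun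
      \<Lambda>\<^esub> \<psi>"
proof -
  let ?F = "bounded_borel_int_fun \<Lambda>"
  interpret F: comm_group ?F by (rule bounded_borel_int_fun_comm_group)
  interpret N: normal "null_int_funs M \<Lambda>" ?F by (rule null_int_funs_normal)
  define h where "h = \<phi> \<otimes>\<^bsub>?F\<^esub> inv\<^bsub>?F\<^esub> \<psi>"
  have hc: "h \<in> carrier ?F" unfolding h_def using assms by simp
  have "h x = \<phi> x - \<psi> x" if "x \<in> \<Lambda>" for x
    using that unfolding h_def bounded_borel_int_fun_minus[OF assms(2)]
    by (simp add: bounded_borel_int_fun_def)
  then have "AE x in M. x \<in> \<Lambda> \<longrightarrow> h x = 0"
    using assms(3) by (auto elim!: eventually_mono)
  with hc have "h \<in> null_int_funs M \<Lambda>" unfolding null_int_funs_def by (intro CollectI conjI)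
  then have "h \<otimes>\<^bsub>?F\<^esub> \<psi> \<in> null_int_funs M \<Lambda> #>\<^bsub>?F\<^esub> \<psi>"
    by (rule F.rcosI[OF _ N.subset assms(2)])
  moreover have "h \<otimes>\<^bsub>?F\<^esub> \<psi> = \<phi>"
    unfolding h_def using assms by (simp add: F.m_assoc)
  ultimately show ?thesis
    using F.repr_independence[OF _ assms(2) N.subgroup_axioms] by simp
qed

text \<open>With z = h e the assumptions read y = z^a = z^b, so both sides equal z^(a b). In the
  application e is the class of an indicator, z is unknown, and y is a trace computed in two
  ways.\<close>

lemma hom_common_power_value:
  fixes a b :: int
  assumes "group G" "group H" "h \<in> hom G H" "e \<in> carrier G"
    and "h (e [^]\<^bsub>G\<^esub> a) = y" "h (e [^]\<^bsub>G\<^esub> b) = y"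
  shows "y [^]\<^bsub>H\<^esub> a = y [^]\<^bsub>H\<^esub> b"
proof -
  interpret H: group H by fact
  have e: "h e \<in> carrier H" using assms(3,4) by (auto simp: hom_def)
  have y: "y = h e [^]\<^bsub>H\<^esub> a" "y = h e [^]\<^bsub>H\<^esub> b"
    using hom_int_pow[OF assms(3,4,1,2)] assms(5,6) by auto
  have "y [^]\<^bsub>H\<^esub> a = h e [^]\<^bsub>H\<^esub> (b * a)"
    unfolding y(2) by (rule H.int_pow_pow[OF e])
  also have "\<dots> = y [^]\<^bsub>H\<^esub> b"
    unfolding y(1) by (simp add: H.int_pow_pow[OF e] mult.commute)
  finally show ?thesis .
qed

text \<open>The factor 1 keeps the base in the form g 1 that \<open>int_pow_unique\<close>
  evaluates.\<close>

lemma bounded_borel_int_indicator_power: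
  assumes "\<sigma> \<in> sets borel"
  shows "(null_int_funs M \<Lambda> #>\<^bsub>bounded_borel_int_fun \<Lambda>\<^esub> (\<lambda>x\<in>\<Lambda>. 1 * indicator \<sigma> x))
      [^]\<^bsub>bounded_borel_int M \<Lambda>\<^esub> (k :: int)
    = null_int_funs M \<Lambda> #>\<^bsub>bounded_borel_int_fun \<Lambda>\<^esub> (\<lambda>x\<in>\<Lambda>. k * indicator \<sigma> x)"
proof -
  let ?F = "bounded_borel_int_fun \<Lambda>"
  interpret N: normal "null_int_funs M \<Lambda>" ?F by (rule null_int_funs_normal)
  interpret Q: group "bounded_borel_int M \<Lambda>"
    unfolding bounded_borel_int_eq by (rule N.factorgroup_is_group)
  have hom: "(\<lambda>\<phi>. null_int_funs M \<Lambda> #>\<^bsub>?F\<^esub> \<phi>) \<in> hom ?F (bounded_borel_int M \<Lambda>)"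
    unfolding bounded_borel_int_eq by (rule N.r_coset_hom_Mod)
  note e = int_indicator_bounded_borel[OF assms, where \<Lambda> = \<Lambda>]
  show ?thesis
  proof (rule Q.int_pow_unique)
    show "null_int_funs M \<Lambda> #>\<^bsub>?F\<^esub> (\<lambda>x\<in>\<Lambda>. i * indicator \<sigma> x) \<in> carrier (bounded_borel_int M \<Lambda>)" for
        i :: int
      by (rule hom_in_carrier[OF hom e])
    have "(\<lambda>x\<in>\<Lambda>. (i + j) * indicator \<sigma> x) = (\<lambda>x\<in>\<Lambda>. i * indicator \<sigma> x) \<otimes>\<^bsub>?F\<^esub> (\<lambda>x\<in>\<Lambda>. j * indicator \<sigma>
        x)" for i j :: int
      by (auto simp: bounded_borel_int_fun_def distrib_right intro!: ext)
    then show "null_int_funs M \<Lambda> #>\<^bsub>?F\<^esub> (\<lambda>x\<in>\<Lambda>. (i + j) * indicator \<sigma> x) =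
      (null_int_funs M \<Lambda> #>\<^bsub>?F\<^esub> (\<lambda>x\<in>\<Lambda>. i * indicator \<sigma> x)) \<otimes>\<^bsub>bounded_borel_int M \<Lambda>\<^esub>
      (null_int_funs M \<Lambda> #>\<^bsub>?F\<^esub> (\<lambda>x\<in>\<Lambda>. j * indicator \<sigma> x))" for i j :: int
      using hom_mult[OF hom e e] by simp
  qed
qed

lemma Linf_class_power:
  assumes f: "f \<in> carrier (ess_bounded_ring M)"
  shows "Linf_class M f [^]\<^bsub>add_monoid (Linf M)\<^esub> (k :: int) = Linf_class M (\<lambda>x. of_int k * f x)"
proof -
  interpret L: cring "Linf M" by (rule Linf_cring)
  note c = ess_bounded_mult[OF ess_bounded_const f]
  have "Linf_class M (\<lambda>x. of_int 1 * f x) [^]\<^bsub>add_monoid (Linf M)\<^esub> k = Linf_class M (\<lambda>x. of_int k *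
      f x)"
  proof (rule group.int_pow_unique[OF L.a_group])
    show "Linf_class M (\<lambda>x. of_int i * f x) \<in> carrier (add_monoid (Linf M))" for i
      using Linf_class_closed[OF c] by simp
    show "Linf_class M (\<lambda>x. of_int (i + j) * f x) =
      Linf_class M (\<lambda>x. of_int i * f x) \<otimes>\<^bsub>add_monoid (Linf M)\<^esub> Linf_class M (\<lambda>x. of_int j * f x)"
          for i j
      using Linf_class_add[OF c c] by (simp add: distrib_right)
  qed
  then show ?thesis by simp
qed

text \<open>Absence of torsion: (a - b) f = 0 almost everywhere, and a - b is a nonzero complex
  number.\<close>

lemma Linf_class_powers_eq:
  assumes f: "f \<in> carrier (ess_bounded_ring M)" and "a \<noteq> b"
    and eq: "Linf_class M f [^]\<^bsub>add_monoid (Linf M)\<^esub> (a :: int) = Linf_class M f [^]\<^bsub>add_monoid (Linf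
        M)\<^esub> b"
  shows "AE x in M. f x = 0"
proof -
  interpret L: cring "Linf M" by (rule Linf_cring)
  have c: "(\<lambda>x. z * f x) \<in> carrier (ess_bounded_ring M)" for z
    by (rule ess_bounded_mult[OF ess_bounded_const f])
  let ?c = "\<lambda>k :: int. Linf_class M (\<lambda>x. of_int k * f x)"
  have cl: "?c k \<in> carrier (Linf M)" for k by (rule Linf_class_closed[OF c])
  have "?c (a - b) \<oplus>\<^bsub>Linf M\<^esub> ?c b = ?c a"
    using Linf_class_add[OF c[of "of_int (a - b)"] c[of "of_int b"]] by (simp add:
        distrib_right[symmetric])
  also have "\<dots> = \<zero>\<^bsub>Linf M\<^esub> \<oplus>\<^bsub>Linf M\<^esub> ?c b"
    using eq cl unfolding Linf_class_power[OF f] by simp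
  finally have "?c (a - b) = \<zero>\<^bsub>Linf M\<^esub>"
    using cl L.add.right_cancel by blast
  then have "AE x in M. of_int (a - b) * f x = 0"
    by (simp only: Linf_class_eq_zero_iff[OF c])
  then show ?thesis
    by eventually_elim (use \<open>a \<noteq> b\<close> in simp)
qed

lemma K0_class_eq_if_iso:
  fixes \<nu> :: "complex measure"
  assumes sets: "sets \<nu> = sets borel" and \<Lambda>: "compact \<Lambda>" and M: "M = completion \<nu>" and n: "n \<ge> 1"
    and A: "A \<in> mats (Linf M) n n" and B: "B \<in> mats (Linf M) n n"
    and iso: "K0_iso_bounded_borel_int M \<Lambda> (2 * n) (mat_dsum (Linf M) n A B)"
  defines "C \<equiv> commutant (mat_ring (Linf M) (2 * n)) (mat_dsum (Linf M) n A B)"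
  shows "K0_class C 1 (scalar_mat C 1 (cring.proj1 (Linf M) n)) = K0_class C 1 (scalar_mat C 1
      (cring.proj2 (Linf M) n))"
proof -
  interpret L: cring "Linf M" by (rule Linf_cring)
  interpret C: ring C unfolding C_def by (rule L.dsum_commutant_ring[OF A B])
  let ?L = "Linf M" and ?F = "bounded_borel_int_fun \<Lambda>" and ?Q = "bounded_borel_int M \<Lambda>"
  let ?P = "L.proj1 n" and ?P' = "L.proj2 n"
  interpret N: normal "null_int_funs M \<Lambda>" ?F by (rule null_int_funs_normal)
  interpret Q: group ?Q unfolding bounded_borel_int_eq by (rule N.factorgroup_is_group)
  obtain \<theta> where \<theta>: "\<theta> \<in> iso (K0 C) ?Q"
    and cut: "\<forall>\<sigma>\<in>sets borel. \<sigma> \<subseteq> \<Lambda> \<longrightarrow> (\<forall>(m, e)\<in>idempotents C. \<forall>\<phi>\<in>\<theta> (K0_class C m e).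
      (\<lambda>x\<in>\<Lambda>. indicator \<sigma> x * \<phi> x) \<in> \<theta> (K0_class C m (cut_down M (2 * n) \<sigma> e)))"
    using iso unfolding K0_iso_bounded_borel_int_def C_def[symmetric] Let_def by (rule bexE)
  have \<theta>_cut: "(\<lambda>x\<in>\<Lambda>. indicator \<sigma> x * \<phi> x) \<in> \<theta> (K0_class C m (cut_down M (2 * n) \<sigma> e))"
    if "\<sigma> \<in> sets borel" "\<sigma> \<subseteq> \<Lambda>" "(m, e) \<in> idempotents C" "\<phi> \<in> \<theta> (K0_class C m e)" for \<sigma> m e \<phi>
    using bspec[OF mp[OF bspec[OF cut that(1)] that(2)] that(3)] that(4) by simp
  have \<theta>_hom: "\<theta> \<in> hom (K0 C) ?Q" and \<theta>_bij: "bij_betw \<theta> (carrier (K0 C)) (carrier ?Q)"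
    using \<theta> by (auto simp: iso_def)
  note tr = L.dsum_commutant_trace[OF A B, folded C_def]
  obtain \<tau> where \<tau>_hom: "\<tau> \<in> hom (K0 C) (add_monoid ?L)"
    and \<tau>: "\<And>m e. (m, e) \<in> idempotents C \<Longrightarrow>
      \<tau> (K0_class C m e) = (\<Oplus>\<^bsub>?L\<^esub>i\<in>{..<m}. \<Oplus>\<^bsub>?L\<^esub>l\<in>{..<n + n}. e i i l l)"
    by (rule C.K0_trace[OF tr(1)]) (rule tr(2), assumption, assumption, blast)
  \<comment> \<open>The trace transported along \<theta> to the function group, where it can be
    evaluated at multiples of an indicator.\<close>
  define \<psi> where "\<psi> = \<tau> \<circ> inv_into (carrier (K0 C)) \<theta>"
  have inv_closed: "inv_into (carrier (K0 C)) \<theta> X \<in> carrier (K0 C)"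
    and inv_right: "\<theta> (inv_into (carrier (K0 C)) \<theta> X) = X" if "X \<in> carrier ?Q" for X
    using that inv_into_into[of X \<theta> "carrier (K0 C)"] f_inv_into_f[of X \<theta> "carrier (K0 C)"]
    unfolding bij_betw_imp_surj_on[OF \<theta>_bij] by blast+
  have inv_left: "inv_into (carrier (K0 C)) \<theta> (\<theta> X) = X" if "X \<in> carrier (K0 C)" for X
    using \<theta>_bij that by (simp add: bij_betw_def)
  have \<psi>_hom: "\<psi> \<in> hom ?Q (add_monoid ?L)"
  proof (rule homI)
    fix X Y assume X: "X \<in> carrier ?Q"
    show "\<psi> X \<in> carrier (add_monoid ?L)"
      unfolding \<psi>_def comp_def by (rule hom_in_carrier[OF \<tau>_hom inv_closed[OF X]])
    assume Y: "Y \<in> carrier ?Q"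
    let ?X = "inv_into (carrier (K0 C)) \<theta> X" and ?Y = "inv_into (carrier (K0 C)) \<theta> Y"
    have "\<theta> (?X \<otimes>\<^bsub>K0 C\<^esub> ?Y) = X \<otimes>\<^bsub>?Q\<^esub> Y"
      unfolding hom_mult[OF \<theta>_hom inv_closed[OF X] inv_closed[OF Y]] by (simp add: inv_right X Y)
    then have "inv_into (carrier (K0 C)) \<theta> (X \<otimes>\<^bsub>?Q\<^esub> Y) = ?X \<otimes>\<^bsub>K0 C\<^esub> ?Y"
      using inv_left[OF C.K0_mult_closed[OF inv_closed[OF X] inv_closed[OF Y]]] by simp
    then show "\<psi> (X \<otimes>\<^bsub>?Q\<^esub> Y) = \<psi> X \<otimes>\<^bsub>add_monoid ?L\<^esub> \<psi> Y"
      unfolding \<psi>_def comp_def using hom_mult[OF \<tau>_hom inv_closed[OF X] inv_closed[OF Y]] by simp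
  qed
  note P = L.dsum_projections[OF A B, folded C_def]
  note P_mats = P(1)[unfolded C_def L.dsum_commutant_carrier, THEN conjunct1]
    P(2)[unfolded C_def L.dsum_commutant_carrier, THEN conjunct1]
  note P_idem = C.scalar_idempotent[OF P(1) P(3)] C.scalar_idempotent[OF P(2) P(4)]
  have \<theta>_closed: "\<theta> (K0_class C m e) \<in> carrier ?Q" if "(m, e) \<in> idempotents C" for m e
    by (rule hom_in_carrier[OF \<theta>_hom C.K0_class_closed[OF that]])
  obtain \<phi> where \<phi>: "\<phi> \<in> carrier ?F" "\<theta> (K0_class C 1 (scalar_mat C 1 ?P)) = null_int_funs M \<Lambda>
      #>\<^bsub>?F\<^esub> \<phi>"
    using \<theta>_closed[OF P_idem(1)] by (rule bounded_borel_int_carrierE)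
  obtain \<phi>' where \<phi>': "\<phi>' \<in> carrier ?F" "\<theta> (K0_class C 1 (scalar_mat C 1 ?P')) = null_int_funs M \<Lambda>
      #>\<^bsub>?F\<^esub> \<phi>'"
    using \<theta>_closed[OF P_idem(2)] by (rule bounded_borel_int_carrierE)
  have null: "AE x in M. \<not> (x \<in> \<Lambda> \<and> \<phi> x = a \<and> \<phi>' x = b)" if "a \<noteq> b" for a b
  proof -
    define \<sigma> where "\<sigma> = {x \<in> \<Lambda>. \<phi> x = a \<and> \<phi>' x = b}"
    \<comment> \<open>Measurability of \<phi> and \<phi>' refers to the subspace \<Lambda>. As
      \<Lambda> is closed, \<sigma> is Borel in the whole plane, as the cut-down condition
      demands.\<close>
    have \<Lambda>_borel: "\<Lambda> \<in> sets borel" using \<Lambda> by (simp add: borel_closed compact_imp_closed)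
    have "\<phi> -` {a} \<inter> space (restrict_space borel \<Lambda>) \<in> sets (restrict_space borel \<Lambda>)"
      "\<phi>' -` {b} \<inter> space (restrict_space borel \<Lambda>) \<in> sets (restrict_space borel \<Lambda>)"
      using \<phi>(1) \<phi>'(1) by (auto simp: bounded_borel_int_fun_carrier intro!: measurable_sets)
    then have "\<phi> -` {a} \<inter> \<Lambda> \<in> sets borel" "\<phi>' -` {b} \<inter> \<Lambda> \<in> sets borel"
      using \<Lambda>_borel by (auto simp: sets_restrict_space_iff space_restrict_space)
    then have "(\<phi> -` {a} \<inter> \<Lambda>) \<inter> (\<phi>' -` {b} \<inter> \<Lambda>) \<in> sets borel" by (rule sets.Int)
    moreover have "(\<phi> -` {a} \<inter> \<Lambda>) \<inter> (\<phi>' -` {b} \<inter> \<Lambda>) = \<sigma>" by (auto simp: \<sigma>_def)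
    ultimately have \<sigma>: "\<sigma> \<in> sets borel" by simp
    have \<sigma>\<Lambda>: "\<sigma> \<subseteq> \<Lambda>" by (auto simp: \<sigma>_def)
    have ind: "indicator \<sigma> \<in> carrier (ess_bounded_ring M)"
      unfolding M by (rule indicator_ess_bounded[OF sets \<sigma>])
    define \<chi>' where "\<chi>' = Linf_class M (indicator \<sigma>)"
    have \<chi>: "\<chi>' \<in> carrier ?L" unfolding \<chi>'_def by (rule Linf_class_closed[OF ind])
    have "(\<lambda>x. indicator \<sigma> x * indicator \<sigma> x) = (indicator \<sigma> :: complex \<Rightarrow> complex)"
      by (auto simp: indicator_def)
    then have \<chi>_idem: "\<chi>' \<otimes>\<^bsub>?L\<^esub> \<chi>' = \<chi>'"
      unfolding \<chi>'_def Linf_class_mult[OF ind ind] by simp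
    define y where "y = Linf_class M (\<lambda>x. of_nat n * indicator \<sigma> x)"
    have y: "(\<Oplus>\<^bsub>?L\<^esub>l\<in>{..<n}. \<chi>') = y"
      unfolding y_def \<chi>'_def by (rule Linf_class_finsum_const[OF ind])
    \<comment> \<open>Stated for a general idempotent p so that it covers both projections. The
      value y does not depend on p, whereas k does.\<close>
    have *: "\<psi> (null_int_funs M \<Lambda> #>\<^bsub>?F\<^esub> (\<lambda>x\<in>\<Lambda>. k * indicator \<sigma> x)) = y"
      if p: "p \<in> carrier C" "p \<otimes>\<^bsub>C\<^esub> p = p" and p_tr: "(\<Oplus>\<^bsub>?L\<^esub>l\<in>{..<n + n}. \<chi>' \<otimes>\<^bsub>?L\<^esub> p l l) =
          (\<Oplus>\<^bsub>?L\<^esub>l\<in>{..<n}. \<chi>')"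
        and \<eta>: "\<eta> \<in> \<theta> (K0_class C 1 (scalar_mat C 1 p))" and k: "\<And>x. x \<in> \<sigma> \<Longrightarrow> \<eta> x = k" for p \<eta> k
    proof -
      define q where "q = (\<lambda>i j. \<chi>' \<otimes>\<^bsub>?L\<^esub> p i j)"
      have p_mats: "p \<in> mats ?L (2 * n) (2 * n)"
        using p(1) by (simp add: C_def commutant_simps mat_ring_simps)
      have q: "q \<in> carrier C"
        unfolding q_def C_def by (rule L.dsum_commutant_smult[OF A B \<chi> p(1)[unfolded C_def]])
      have q_idem: "(1, scalar_mat C 1 q) \<in> idempotents C"
        unfolding q_def
        by (rule C.scalar_idempotent[OF q[unfolded q_def]
              L.dsum_commutant_smult_idempotent[OF A B \<chi> \<chi>_idem p[unfolded C_def], folded C_def]])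
      have cut: "cut_down M (2 * n) \<sigma> (scalar_mat C 1 p) = scalar_mat C 1 q"
        unfolding q_def C_def \<chi>'_def by (rule cut_down_scalar[OF p_mats \<chi>[unfolded \<chi>'_def]])
      \<comment> \<open>On \<sigma> the representative \<eta> is constantly k, so its cut-down is k
        times the indicator. This makes the image of the cut-down class explicit.\<close>
      have "(\<lambda>x\<in>\<Lambda>. k * indicator \<sigma> x) = (\<lambda>x\<in>\<Lambda>. indicator \<sigma> x * \<eta> x)"
        using k by (auto simp: indicator_def)
      then have "(\<lambda>x\<in>\<Lambda>. k * indicator \<sigma> x) \<in> \<theta> (K0_class C 1 (scalar_mat C 1 q))"
        using \<theta>_cut[OF \<sigma> \<sigma>\<Lambda> C.scalar_idempotent[OF p] \<eta>] unfolding cut by simp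
      from bounded_borel_int_mem[OF \<theta>_closed[OF q_idem] this]
      have "\<psi> (null_int_funs M \<Lambda> #>\<^bsub>?F\<^esub> (\<lambda>x\<in>\<Lambda>. k * indicator \<sigma> x)) = \<tau> (K0_class C 1 (scalar_mat C 1
          q))"
        unfolding \<psi>_def comp_def using inv_left[OF C.K0_class_closed[OF q_idem]] by simp
      also have "\<dots> = (\<Oplus>\<^bsub>?L\<^esub>l\<in>{..<n + n}. q l l)"
        unfolding \<tau>[OF q_idem] by (rule C.K0_trace_scalar[OF tr(1) q])
      also have "\<dots> = y"
        unfolding q_def p_tr y ..
      finally show ?thesis .
    qed
    note N_self = N.rcos_self[OF _ N.subgroup_axioms]
    have ya: "\<psi> (null_int_funs M \<Lambda> #>\<^bsub>?F\<^esub> (\<lambda>x\<in>\<Lambda>. a * indicator \<sigma> x)) = y"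
      by (rule *[OF P(1) P(3) L.dsum_projections_smult_trace(1)[OF \<chi>], of \<phi>])
         (use \<phi>(2) N_self[OF \<phi>(1)] in \<open>auto simp: \<sigma>_def\<close>)
    have yb: "\<psi> (null_int_funs M \<Lambda> #>\<^bsub>?F\<^esub> (\<lambda>x\<in>\<Lambda>. b * indicator \<sigma> x)) = y"
      by (rule *[OF P(2) P(4) L.dsum_projections_smult_trace(2)[OF \<chi>], of \<phi>'])
         (use \<phi>'(2) N_self[OF \<phi>'(1)] in \<open>auto simp: \<sigma>_def\<close>)
    have e: "null_int_funs M \<Lambda> #>\<^bsub>?F\<^esub> (\<lambda>x\<in>\<Lambda>. 1 * indicator \<sigma> x) \<in> carrier ?Q"
      unfolding bounded_borel_int_eq by (rule hom_in_carrier[OF N.r_coset_hom_Mod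
          int_indicator_bounded_borel[OF \<sigma>]])
    \<comment> \<open>The classes of a and b times the indicator are powers of one class, and \<psi>
      sends both to y.\<close>
    have "y [^]\<^bsub>add_monoid ?L\<^esub> a = y [^]\<^bsub>add_monoid ?L\<^esub> b"
      by (rule hom_common_power_value[OF Q.group_axioms L.a_group \<psi>_hom e])
         (simp_all only: bounded_borel_int_indicator_power[OF \<sigma>] ya yb)
    then have "AE x in M. of_nat n * indicator \<sigma> x = (0 :: complex)"
      unfolding y_def by (rule Linf_class_powers_eq[OF ess_bounded_mult[OF ess_bounded_const ind]
          \<open>a \<noteq> b\<close>])
    then show ?thesis
      \<comment> \<open>Here n is nonzero, so almost no point lies in \<sigma>.\<close>
      by eventually_elim (use n in \<open>auto simp: \<sigma>_def indicator_def split: if_splits\<close>)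
  qed
  \<comment> \<open>There are only countably many pairs of integers, so the exceptional null sets
    can be united.\<close>
  have "AE x in M. \<forall>a b. a \<noteq> b \<longrightarrow> \<not> (x \<in> \<Lambda> \<and> \<phi> x = a \<and> \<phi>' x = b)"
    unfolding AE_all_countable using null by (auto simp: AE_all_countable)
  then have "AE x in M. x \<in> \<Lambda> \<longrightarrow> \<phi> x = \<phi>' x"
    by eventually_elim blast
  then have "\<theta> (K0_class C 1 (scalar_mat C 1 ?P)) = \<theta> (K0_class C 1 (scalar_mat C 1 ?P'))"
    unfolding \<phi>(2) \<phi>'(2) by (rule bounded_borel_int_coset_eqI[OF \<phi>(1) \<phi>'(1)])
  then show ?thesis
    using \<theta>_bij C.K0_class_closed[OF P_idem(1)] C.K0_class_closed[OF P_idem(2)]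
    by (auto simp: bij_betw_def dest: inj_onD)
qed

theorem proposition4p7:
  fixes \<nu> \<mu> :: "complex measure" and \<Lambda> :: "complex set" and n :: nat
    and A1 A2 :: "nat \<Rightarrow> nat \<Rightarrow> (complex \<Rightarrow> complex) set"
  assumes "sets \<nu> = sets borel" and "finite_measure \<nu>"
    and "compact \<Lambda>" and "emeasure \<nu> (- \<Lambda>) = 0"
    and "\<mu> = completion \<nu>"
    and "n \<ge> 1"
    and "A1 \<in> carrier (mat_ring (Linf \<mu>) n)"
    and "A2 \<in> carrier (mat_ring (Linf \<mu>) n)"
    and "\<And>k l. k < n \<Longrightarrow> l < n \<Longrightarrow> l < k \<Longrightarrow> A1 k l = \<zero>\<^bsub>Linf \<mu>\<^esub>"
    and "\<And>k l. k < n \<Longrightarrow> l < n \<Longrightarrow> l < k \<Longrightarrow> A2 k l = \<zero>\<^bsub>Linf \<mu>\<^esub>"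
    and "\<And>k l. k < n \<Longrightarrow> l < n \<Longrightarrow> A1 k k = A1 l l"
    and "\<And>k l. k < n \<Longrightarrow> l < n \<Longrightarrow> A2 k k = A2 l l"
    and "\<And>k. k + 1 < n \<Longrightarrow> full_support \<mu> \<Lambda> (A1 k (k + 1))"
    and "\<And>k. k + 1 < n \<Longrightarrow> full_support \<mu> \<Lambda> (A2 k (k + 1))"
    and "K0_iso_bounded_borel_int \<mu> \<Lambda> (2 * n) (mat_dsum (Linf \<mu>) n A1 A2)"
  shows "similar_in (mat_ring (Linf \<mu>) n) A1 A2"
proof -
  interpret L: cring "Linf \<mu>" by (rule Linf_cring)
  have A: "A1 \<in> mats (Linf \<mu>) n n" "A2 \<in> mats (Linf \<mu>) n n"
    using assms(7,8) by (simp_all add: mat_ring_simps)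
  have "- \<Lambda> \<in> sets \<nu>"
    using assms(1,3) by (simp add: borel_closed compact_imp_closed borel_comp)
  then have "AE x in \<nu>. x \<notin> - \<Lambda>"
    using assms(4) by (intro AE_not_in) (simp add: null_sets_def)
  then have \<Lambda>: "AE x in \<mu>. x \<in> \<Lambda>"
    unfolding assms(5) by (intro AE_completion) simp
  have regular: "L.regular_triangular n X"
    if X: "X \<in> mats (Linf \<mu>) n n" and tri: "\<And>k l. k < n \<Longrightarrow> l < n \<Longrightarrow> l < k \<Longrightarrow> X k l = \<zero>\<^bsub>Linf \<mu>\<^esub>"
      and diag: "\<And>k l. k < n \<Longrightarrow> l < n \<Longrightarrow> X k k = X l l"
      and supp: "\<And>k. k + 1 < n \<Longrightarrow> full_support \<mu> \<Lambda> (X k (k + 1))" for X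
    unfolding L.regular_triangular_def
  proof (intro conjI allI impI ballI)
    fix k l :: nat assume "l < k"
    \<comment> \<open>The hypotheses speak of indices below n, while
      \<open>regular_triangular\<close> asks for all l < k. For k at least n, the row is zero by the
      convention of \<open>mats\<close>.\<close>
    then show "X k l = \<zero>\<^bsub>Linf \<mu>\<^esub>"
      using tri[of k l] L.mats_row_zero[OF X, of k l] by (cases "k < n") auto
  next
    fix k r assume "k + 1 < n" "r \<in> carrier (Linf \<mu>)" "X k (k + 1) \<otimes>\<^bsub>Linf \<mu>\<^esub> r = \<zero>\<^bsub>Linf \<mu>\<^esub>"
    then show "r = \<zero>\<^bsub>Linf \<mu>\<^esub>"
      using full_support_regular[OF L.mats_carrier[OF X] supp \<Lambda>] by blast
  qed (use X diag in blast)+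
  show ?thesis
    by (rule L.similar_if_K0_class_eq[OF Linf_reduced regular[OF A(1) assms(9,11,13)] regular[OF
        A(2) assms(10,12,14)]
          K0_class_eq_if_iso[OF assms(1,3,5,6) A assms(15)] assms(6)])
qed

end
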